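(* Consider weighted graphs $G=(V,E,w)$ with $w(e)\ge1$ for all edges (equivalently, unweighted multigraphs) in the model where, in each synchronous round, $B\cdot w(e)$ bits can be sent over each edge $e$. For any $\alpha\ge1$, any randomized distributed algorithm that with constant error probability computes an $\alpha$-approximation of the edge connectivity $\lambda$, or that computes an $\alpha$-approximate minimum cut (even if $\lambda$ is known to all nodes), requires at least $\Omega\big(D+\sqrt{n/(B\log n)}\big)$ rounds on $n$-node graphs of unweighted diameter $D$; this holds even for graphs of diameter $D=O(\log n)$.
   Context: Nodes have unique identifiers and initially know their incident edges and weights. For a nonempty proper $C\subset V$, $w(C)$ is the total weight of edges with exactly one endpoint in $C$; the edge connectivity is $\lambda=\min_C w(C)$; a cut $(C,V\setminus C)$ is $\alpha$-minimum (an $\alpha$-approximate minimum cut) if $w(C)\le\alpha\lambda$, and computing it means each node $v$ learns whether $v\in C$. An $\alpha$-approximation of $\lambda$ means every node outputs a value $\tilde{\lambda}\in[\lambda,\alpha\lambda]$. $D$ is the unweighted (hop) diameter. *)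

theory Defs
  imports "HOL-Probability.Probability"
begin

section \<open>Weighted graphs, edge connectivity, hop diameter\<close>

text \<open>Vertices are natural numbers, which double as the unique identifiers of the nodes.\<close>

record wgraph =
  verts :: "nat set"
  edges :: "nat set set"
  weight :: "nat set \<Rightarrow> real"

definition weighted_graph :: "wgraph \<Rightarrow> bool" where
  "weighted_graph G \<longleftrightarrow>
     finite (verts G) \<and>
     (\<forall>e\<in>edges G. e \<subseteq> verts G \<and> card e = 2) \<and>
     (\<forall>e\<in>edges G. weight G e \<ge> 1)"

definition proper_side :: "wgraph \<Rightarrow> nat set \<Rightarrow> bool" where
  "proper_side G C \<longleftrightarrow> C \<noteq> {} \<and> C \<subset> verts G"

definition cut_weight :: "wgraph \<Rightarrow> nat set \<Rightarrow> real" where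
  "cut_weight G C = (\<Sum>e | e \<in> edges G \<and> card (e \<inter> C) = 1. weight G e)"

definition edge_connectivity :: "wgraph \<Rightarrow> real" where
  "edge_connectivity G = Min (cut_weight G ` {C. proper_side G C})"

definition approx_min_cut :: "real \<Rightarrow> wgraph \<Rightarrow> nat set \<Rightarrow> bool" where
  "approx_min_cut \<alpha> G C \<longleftrightarrow>
     proper_side G C \<and> cut_weight G C \<le> \<alpha> * edge_connectivity G"

definition adjacency :: "wgraph \<Rightarrow> (nat \<times> nat) set" where
  "adjacency G = {(u, v). {u, v} \<in> edges G}"

definition connected_graph :: "wgraph \<Rightarrow> bool" where
  "connected_graph G \<longleftrightarrow> (\<forall>u\<in>verts G. \<forall>v\<in>verts G. (u, v) \<in> (adjacency G)\<^sup>*)"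

definition hop_dist :: "wgraph \<Rightarrow> nat \<Rightarrow> nat \<Rightarrow> nat" where
  "hop_dist G u v = (LEAST k. (u, v) \<in> adjacency G ^^ k)"

definition hop_diameter :: "wgraph \<Rightarrow> nat" where
  "hop_diameter G = Max {hop_dist G u v | u v. u \<in> verts G \<and> v \<in> verts G}"

text \<open>
  The inputs on which an algorithm has to be correct.  The identifiers are exactly 0, ..., n - 1;
  a lower bound for this case implies one for every larger identifier space.  The set \<open>W\<close>
  restricts the weights: \<open>UNIV\<close> gives arbitrary real weights that are at least 1, and
  \<open>\<nat>\<close> gives integer weights, that is, edge multiplicities of an unweighted multigraph.
\<close>

definition inputs :: "real set \<Rightarrow> nat \<Rightarrow> nat \<Rightarrow> wgraph set" where
  "inputs W n D =
     {G. weighted_graph G \<and> weight G ` edges G \<subseteq> W \<and> verts G = {..<n} \<and>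
         connected_graph G \<and> hop_diameter G = D}"

section \<open>Randomized synchronous message passing\<close>

text \<open>
  Nodes have unbounded memory and computational power, so without loss of generality the state
  of a node is everything it has seen so far: its identifier, the neighbours and weights of its
  incident edges, its private random values, and the messages received (one inbox, indexed by the
  sender, per completed round).  Since the state is a fixed type, the constants
  of a lower bound cannot depend on the choice of a state space.
\<close>

record history =
  ident :: nat
  incident :: "nat \<rightharpoonup> real"
  coins :: "nat list"
  received :: "(nat \<Rightarrow> bool list) list"

text \<open>
  A node draws one random value when it starts and one after every round, from any discrete
  distribution, which may depend on its history.  Then \<open>send A h u\<close> is the bit string that a
  node with history \<open>h\<close> sends to its neighbour \<open>u\<close>, and \<open>answer A h\<close> is its output if the
  execution stops now.  All nodes run the same algorithm.
\<close>

record 'o algorithm =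
  coin :: "history \<Rightarrow> nat pmf"
  send :: "history \<Rightarrow> nat \<Rightarrow> bool list"
  answer :: "history \<Rightarrow> 'o"

definition draw_coin :: "'o algorithm \<Rightarrow> history \<Rightarrow> history pmf" where
  "draw_coin A h = map_pmf (\<lambda>r. h\<lparr>coins := coins h @ [r]\<rparr>) (coin A h)"

definition start :: "wgraph \<Rightarrow> nat \<Rightarrow> history" where
  "start G v =
     \<lparr>ident = v,
      incident = (\<lambda>u. if {u, v} \<in> edges G then Some (weight G {u, v}) else None),
      coins = [],
      received = []\<rparr>"

text \<open>
  Bandwidth: in one round an edge \<open>e\<close> delivers, in each direction, at most the first
  \<open>\<lfloor>B * weight G e\<rfloor>\<close> bits of what is sent.  An algorithm that keeps within this
  limit is unaffected by the truncation.
\<close>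

definition inbox :: "nat \<Rightarrow> 'o algorithm \<Rightarrow> wgraph \<Rightarrow> (nat \<Rightarrow> history) \<Rightarrow> nat \<Rightarrow> nat \<Rightarrow> bool list" where
  "inbox B A G \<sigma> v =
     (\<lambda>u. if {u, v} \<in> edges G
           then take (nat \<lfloor>real B * weight G {u, v}\<rfloor>) (send A (\<sigma> u) v)
           else [])"

definition receive :: "(nat \<Rightarrow> bool list) \<Rightarrow> history \<Rightarrow> history" where
  "receive m h = h\<lparr>received := received h @ [m]\<rparr>"

text \<open>
  The joint distribution of all node histories after \<open>T\<close> rounds.  The product distribution
  makes the random choices of different nodes independent.
\<close>

primrec execution :: "nat \<Rightarrow> 'o algorithm \<Rightarrow> wgraph \<Rightarrow> nat \<Rightarrow> (nat \<Rightarrow> history) pmf" where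
  "execution B A G 0 = Pi_pmf (verts G) undefined (\<lambda>v. draw_coin A (start G v))"
| "execution B A G (Suc T) =
     bind_pmf (execution B A G T)
       (\<lambda>\<sigma>. Pi_pmf (verts G) undefined (\<lambda>v. draw_coin A (receive (inbox B A G \<sigma> v) (\<sigma> v))))"

section \<open>The two problems\<close>

definition approximates_connectivity ::
    "nat \<Rightarrow> real \<Rightarrow> real \<Rightarrow> wgraph set \<Rightarrow> nat \<Rightarrow> real algorithm \<Rightarrow> bool" where
  "approximates_connectivity B \<alpha> \<epsilon> \<G> T A \<longleftrightarrow>
     (\<forall>G\<in>\<G>. measure_pmf.prob (execution B A G T)
        {\<sigma>. \<forall>v\<in>verts G. answer A (\<sigma> v) \<in> {edge_connectivity G .. \<alpha> * edge_connectivity G}}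
        \<ge> 1 - \<epsilon>)"

text \<open>
  That the edge connectivity is known to all nodes is expressed by letting the algorithm
  depend on its value.  The computed side of the cut consists of the nodes with output \<open>True\<close>.
\<close>

definition computes_min_cut_knowing_connectivity ::
    "nat \<Rightarrow> real \<Rightarrow> real \<Rightarrow> wgraph set \<Rightarrow> nat \<Rightarrow> (real \<Rightarrow> bool algorithm) \<Rightarrow> bool" where
  "computes_min_cut_knowing_connectivity B \<alpha> \<epsilon> \<G> T A \<longleftrightarrow>
     (\<forall>G\<in>\<G>. let A' = A (edge_connectivity G) in
        measure_pmf.prob (execution B A' G T)
          {\<sigma>. approx_min_cut \<alpha> G {v \<in> verts G. answer A' (\<sigma> v)}}
          \<ge> 1 - \<epsilon>)"

end

theory Submission imports Defs begin

text \<open>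
  Deciding whether \<open>|x \<inter> y|\<close> is divisible by 3, for \<open>x, y \<subseteq> {0, \<dots>, m - 1}\<close>, needs \<open>\<Omega>(m)\<close> bits of randomized
  communication, because the matrix \<open>\<omega>\<^bsup>|x \<inter> y|\<^esup>\<close>, with \<open>\<omega>\<close> a primitive cube root of unity, is a tensor
  power with exponentially small discrepancy. The problem is encoded in a graph of \<open>O(m)\<close> long
  paths of heavy edges whose left ends are connected according to \<open>x\<close> and whose right ends according
  to \<open>y\<close>: three strands run through all paths and are permuted by commutators of transpositions of
  \<open>S\<^sub>3\<close>, so one end of a strand tells \<open>|x \<inter> y|\<close> modulo 3, and finding the only light cut, or just its
  existence, reveals the answer. Information travels along the heavy paths only one column per
  round, whatever their bandwidth. The shortcuts that make the diameter logarithmic have weight 1,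
  and only logarithmically many of them cross any column, so \<open>T\<close> rounds yield a protocol with
  \<open>O(T B log n)\<close> bits unless \<open>T\<close> is of the order of the path length. Paths of length about
  \<open>sqrt (n / (B log n))\<close> balance the two. The bound \<open>\<Omega>(D)\<close> comes from a path with a single light edge
  that far away nodes cannot locate.
\<close>

section \<open>Two-party simulation of a distributed algorithm\<close>

text \<open>All graphs \<open>G p\<close>, \<open>p \<in> P\<close>, are run on one probability space: each node draws one coin per
  history that it has in some of the runs, so that runs in which a node has seen the same draw the
  same coin. This replaces public random tapes and keeps all distributions discrete.\<close>

definition joint_draw ::
    "'o algorithm \<Rightarrow> nat set \<Rightarrow> 'i set \<Rightarrow> ('i \<Rightarrow> nat \<Rightarrow> history) \<Rightarrow> ('i \<Rightarrow> nat \<Rightarrow> history) pmf" where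
  "joint_draw A V P S =
     map_pmf (\<lambda>\<rho> p v. if v \<in> V then (S p v)\<lparr>coins := coins (S p v) @ [\<rho> v (S p v)]\<rparr> else undefined)
       (Pi_pmf V (\<lambda>_. 0) (\<lambda>v. Pi_pmf ((\<lambda>p. S p v) ` P) 0 (coin A)))"

primrec joint_execution ::
    "nat \<Rightarrow> 'o algorithm \<Rightarrow> nat set \<Rightarrow> 'i set \<Rightarrow> ('i \<Rightarrow> wgraph) \<Rightarrow> nat \<Rightarrow> ('i \<Rightarrow> nat \<Rightarrow> history) pmf" where
  "joint_execution B A V P G 0 = joint_draw A V P (\<lambda>p. start (G p))"
| "joint_execution B A V P G (Suc T) =
     bind_pmf (joint_execution B A V P G T)
       (\<lambda>S. joint_draw A V P (\<lambda>p v. receive (inbox B A (G p) (S p) v) (S p v)))"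

text \<open>For fixed \<open>p\<close>, node \<open>v\<close> reads a single component of its table,
  and a component of a product distribution keeps its own law. The coupling thus affects only how
  different runs are correlated.\<close>

lemma map_pmf_joint_draw:
  assumes "finite V" "finite P" "p \<in> P"
  shows "map_pmf (\<lambda>S. S p) (joint_draw A V P S) = Pi_pmf V undefined (\<lambda>v. draw_coin A (S p v))"
proof -
  let ?u = "\<lambda>v \<rho>. (S p v)\<lparr>coins := coins (S p v) @ [\<rho> (S p v)]\<rparr>"
  let ?Q = "\<lambda>v. Pi_pmf ((\<lambda>p. S p v) ` P) 0 (coin A)"
  have comp: "draw_coin A (S p v) = bind_pmf (?Q v) (\<lambda>\<rho>. return_pmf (?u v \<rho>))" for v
  proof -
    have "coin A (S p v) = map_pmf (\<lambda>\<rho>. \<rho> (S p v)) (?Q v)"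
      using assms by (subst Pi_pmf_component) auto
    then show ?thesis
      by (simp add: draw_coin_def map_pmf_comp flip: map_pmf_def)
  qed
  have "Pi_pmf V undefined (\<lambda>v. draw_coin A (S p v)) =
        bind_pmf (Pi_pmf V (\<lambda>_. 0) ?Q) (\<lambda>\<rho>. Pi_pmf V undefined (\<lambda>v. return_pmf (?u v (\<rho> v))))"
    unfolding comp using assms(1) by (subst Pi_pmf_bind) auto
  also have "\<dots> = map_pmf (\<lambda>S. S p) (joint_draw A V P S)"
    using assms(1) by (simp add: joint_draw_def map_pmf_comp) (simp add: map_pmf_def)
  finally show ?thesis ..
qed

lemma map_pmf_joint_execution:
  assumes "finite V" "finite P" "p \<in> P" "verts (G p) = V"
  shows "map_pmf (\<lambda>S. S p) (joint_execution B A V P G T) = execution B A (G p) T"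
proof (induction T)
  case 0
  show ?case using assms by (simp add: map_pmf_joint_draw)
next
  case (Suc T)
  show ?case
    using assms by (simp add: map_bind_pmf map_pmf_joint_draw bind_map_pmf flip: Suc.IH)
qed

lemma finite_bool_lists: "finite {xs :: bool list. length xs \<le> B}"
  using finite_lists_length_le[OF finite_class.finite_UNIV, of B] by simp

text \<open>Truncation only bounds the length of a message, so shorter strings count as well; hence
  the exponent \<open>Suc B\<close>.\<close>

lemma card_bool_lists_le: "card {xs :: bool list. length xs \<le> B} \<le> 2 ^ Suc B"
proof -
  have "card {xs :: bool list. set xs \<subseteq> UNIV \<and> length xs \<le> B} = (\<Sum>i\<le>B. 2 ^ i)"
    by (subst card_lists_length_le) auto
  also have "\<dots> < 2 ^ Suc B"
    by (induction B) auto
  finally show ?thesis by simp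
qed

text \<open>After \<open>t\<close> rounds the party holding \<open>x\<close> knows the histories in \<open>left t\<close>, the party holding \<open>y\<close>
  those in \<open>right t\<close>; the zones shrink and may overlap, and only the messages along \<open>crossing t\<close>
  (sender first) have to be exchanged.\<close>

locale two_party =
  fixes X :: "'x set" and Y :: "'y set" and G :: "'x \<Rightarrow> 'y \<Rightarrow> wgraph"
    and V :: "nat set" and left right :: "nat \<Rightarrow> nat set"
    and crossing :: "nat \<Rightarrow> (nat \<times> nat) set" and K T :: nat
  assumes finite_X: "finite X" and finite_Y: "finite Y" and finite_V: "finite V"
    and verts_G: "x \<in> X \<Longrightarrow> y \<in> Y \<Longrightarrow> verts (G x y) = V"
    and left_Suc: "left (Suc t) \<subseteq> left t" and right_Suc: "right (Suc t) \<subseteq> right t"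
    and start_left: "x \<in> X \<Longrightarrow> y \<in> Y \<Longrightarrow> y' \<in> Y \<Longrightarrow> v \<in> left 0 \<Longrightarrow> start (G x y) v = start (G x y') v"
    and start_right: "x \<in> X \<Longrightarrow> x' \<in> X \<Longrightarrow> y \<in> Y \<Longrightarrow> v \<in> right 0 \<Longrightarrow> start (G x y) v = start (G x' y) v"
    and edge_left: "t < T \<Longrightarrow> x \<in> X \<Longrightarrow> y \<in> Y \<Longrightarrow> v \<in> left (Suc t) \<Longrightarrow> {u, v} \<in> edges (G x y) \<Longrightarrow>
           u \<in> left t \<or> (u, v) \<in> crossing t"
    and edge_right: "t < T \<Longrightarrow> x \<in> X \<Longrightarrow> y \<in> Y \<Longrightarrow> v \<in> right (Suc t) \<Longrightarrow> {u, v} \<in> edges (G x y) \<Longrightarrow>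
           u \<in> right t \<or> (u, v) \<in> crossing t"
    and crossing_sender: "t < T \<Longrightarrow> (u, v) \<in> crossing t \<Longrightarrow> u \<in> left t \<union> right t"
    and crossing_weight: "(u, v) \<in> crossing t \<Longrightarrow> x \<in> X \<Longrightarrow> y \<in> Y \<Longrightarrow> {u, v} \<in> edges (G x y) \<Longrightarrow>
           weight (G x y) {u, v} = 1"
    and finite_crossing: "finite (crossing t)" and card_crossing: "card (crossing t) \<le> K"
begin

text \<open>\<open>\<tau> x y\<close> is the transcript of crossing messages. By cut and paste, each transcript class is a
  rectangle on which the left zone depends on \<open>x\<close> alone and the right zone on \<open>y\<close> alone.\<close>

definition rectangular ::
    "nat \<Rightarrow> ('x \<Rightarrow> 'y \<Rightarrow> (nat \<times> nat \<Rightarrow> bool list) list) \<Rightarrow> ('x \<Rightarrow> 'y \<Rightarrow> nat \<Rightarrow> history) \<Rightarrow> bool" where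
  "rectangular t \<tau> S \<longleftrightarrow>
     (\<forall>x\<in>X. \<forall>x'\<in>X. \<forall>y\<in>Y. \<forall>y'\<in>Y. \<tau> x y = \<tau> x' y' \<longrightarrow>
        \<tau> x y' = \<tau> x y \<and> (\<forall>v\<in>left t. S x y' v = S x y v) \<and> (\<forall>v\<in>right t. S x y' v = S x' y' v))"

definition simulated :: "nat \<Rightarrow> nat \<Rightarrow> ('x \<Rightarrow> 'y \<Rightarrow> nat \<Rightarrow> history) \<Rightarrow> bool" where
  "simulated k t S \<longleftrightarrow> (\<exists>\<tau>. card (case_prod \<tau> ` (X \<times> Y)) \<le> k \<and> rectangular t \<tau> S)"

lemma rectangularD:
  assumes "rectangular t \<tau> S" "x \<in> X" "x' \<in> X" "y \<in> Y" "y' \<in> Y" "\<tau> x y = \<tau> x' y'"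
  shows "\<tau> x y' = \<tau> x y"
    and "v \<in> left t \<Longrightarrow> S x y' v = S x y v"
    and "v \<in> right t \<Longrightarrow> S x y' v = S x' y' v"
  using assms unfolding rectangular_def by blast+

text \<open>Once the tables are fixed, a coin is a function of node and history, so equal histories
  stay equal. This is what drawing coins per history achieves.\<close>

lemma simulated_joint_draw:
  assumes "simulated k t (\<lambda>x y. S (x, y))" "S' \<in> set_pmf (joint_draw A V P S)"
  shows "simulated k t (\<lambda>x y. S' (x, y))"
proof -
  from assms(2) obtain \<rho> where S':
    "S' = (\<lambda>p v. if v \<in> V then (S p v)\<lparr>coins := coins (S p v) @ [\<rho> v (S p v)]\<rparr> else undefined)"
    unfolding joint_draw_def by auto
  have "S' p v = S' p' v" if "S p v = S p' v" for p p' v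
    using that by (simp add: S')
  then show ?thesis
    using assms(1) unfolding simulated_def rectangular_def by meson
qed

text \<open>Appending the crossing messages to the transcript splits every class into at most
  \<open>(2 ^ Suc B) ^ K\<close> parts. A node of the next zone hears from the old zone, where
  histories are already determined, or along a crossing pair, whose message is in the
  transcript.\<close>

lemma simulated_receive:
  assumes "simulated k t (\<lambda>x y. S (x, y))" "t < T"
  shows "simulated (k * (2 ^ Suc B) ^ K) (Suc t)
    (\<lambda>x y v. receive (inbox B A (G x y) (S (x, y)) v) (S (x, y) v))"
proof -
  obtain \<tau> where card: "card (case_prod \<tau> ` (X \<times> Y)) \<le> k" and
    rect: "rectangular t \<tau> (\<lambda>x y. S (x, y))"
    using assms(1) unfolding simulated_def by blast
  note \<tau> = rectangularD[OF rect]
  \<comment> \<open>Recorded for every crossing pair, edge or not. Crossing edges have weight 1, so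
    \<open>take B\<close> is what they deliver; the value \<open>[]\<close> elsewhere puts
    \<open>m x y\<close> into the finite set \<open>?M\<close>.\<close>
  define m where "m x y = (\<lambda>(u, v). if (u, v) \<in> crossing t then take B (send A (S (x, y) u) v) else [])" for x y
  define \<tau>' where "\<tau>' x y = m x y # \<tau> x y" for x y
  let ?M = "PiE_dflt (crossing t) [] (\<lambda>_. {xs :: bool list. length xs \<le> B})"
  have finM: "finite ?M"
    by (intro finite_PiE_dflt finite_crossing finite_bool_lists)
  have "card ?M \<le> (\<Prod>_\<in>crossing t. 2 ^ Suc B)"
    by (subst card_PiE_dflt) (intro finite_crossing finite_bool_lists prod_mono conjI card_bool_lists_le zero_le)+
  also have "\<dots> \<le> (2 ^ Suc B) ^ K"
    using card_crossing by (simp only: prod_constant) (intro power_increasing, auto)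
  finally have cardM: "card ?M \<le> (2 ^ Suc B) ^ K" .
  have "case_prod \<tau>' ` (X \<times> Y) \<subseteq> (\<lambda>(l, f). f # l) ` (case_prod \<tau> ` (X \<times> Y) \<times> ?M)"
    by (force simp: \<tau>'_def m_def PiE_dflt_def)
  then have "card (case_prod \<tau>' ` (X \<times> Y)) \<le> card ((\<lambda>(l, f). f # l) ` (case_prod \<tau> ` (X \<times> Y) \<times> ?M))"
    using finM finite_X finite_Y by (intro card_mono) auto
  also have "\<dots> \<le> card (case_prod \<tau> ` (X \<times> Y) \<times> ?M)"
    using finM finite_X finite_Y by (intro card_image_le) auto
  also have "\<dots> \<le> k * (2 ^ Suc B) ^ K"
    unfolding card_cartesian_product by (intro mult_mono card cardM) auto
  finally have 1: "card (case_prod \<tau>' ` (X \<times> Y)) \<le> k * (2 ^ Suc B) ^ K" .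
  have left0: "left t \<subseteq> left 0" for t
    by (induction t) (use left_Suc in auto)
  have right0: "right t \<subseteq> right 0" for t
    by (induction t) (use right_Suc in auto)
  \<comment> \<open>Equal start histories mean equal incident edges and weights at \<open>v\<close>,
    so the inboxes can be compared sender by sender although the graphs differ.\<close>
  have inbox_eq: "inbox B A (G x y) (S (x, y)) v = inbox B A (G x' y') (S (x', y')) v"
    if xy: "x \<in> X" "x' \<in> X" "y \<in> Y" "y' \<in> Y" and st: "start (G x y) v = start (G x' y') v"
      and m: "m x y = m x' y'"
      and nb: "\<And>u. {u, v} \<in> edges (G x y) \<Longrightarrow> S (x, y) u = S (x', y') u \<or> (u, v) \<in> crossing t"
    for x x' y y' v
  proof
    fix u
    have inc: "(if {u, v} \<in> edges (G x y) then Some (weight (G x y) {u, v}) else None) =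
        (if {u, v} \<in> edges (G x' y') then Some (weight (G x' y') {u, v}) else None)"
      using fun_cong[OF arg_cong[OF st, of incident], of u] by (simp add: start_def)
    show "inbox B A (G x y) (S (x, y)) v u = inbox B A (G x' y') (S (x', y')) v u"
    proof (cases "{u, v} \<in> edges (G x y)")
      case False
      then show ?thesis using inc by (auto simp: inbox_def split: if_splits)
    next
      case True
      then have e': "{u, v} \<in> edges (G x' y')" and w: "weight (G x y) {u, v} = weight (G x' y') {u, v}"
        using inc by (auto split: if_splits)
      show ?thesis
      proof (cases "(u, v) \<in> crossing t")
        case cr: True
        have "take B (send A (S (x, y) u) v) = take B (send A (S (x', y') u) v)"
          using fun_cong[OF m, of "(u, v)"] cr by (simp add: m_def)
        then show ?thesis
          using crossing_weight[OF cr \<open>x \<in> X\<close> \<open>y \<in> Y\<close> True] w True e' by (simp add: inbox_def)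
      next
        case False
        then show ?thesis using nb[OF True] True e' w by (simp add: inbox_def)
      qed
    qed
  qed
  have 2: "\<tau>' x y' = \<tau>' x y \<and>
      (\<forall>v\<in>left (Suc t). receive (inbox B A (G x y') (S (x, y')) v) (S (x, y') v) =
         receive (inbox B A (G x y) (S (x, y)) v) (S (x, y) v)) \<and>
      (\<forall>v\<in>right (Suc t). receive (inbox B A (G x y') (S (x, y')) v) (S (x, y') v) =
         receive (inbox B A (G x' y') (S (x', y')) v) (S (x', y') v))"
    if xy: "x \<in> X" "x' \<in> X" "y \<in> Y" "y' \<in> Y" and eq: "\<tau>' x y = \<tau>' x' y'" for x x' y y'
  proof -
    have t: "\<tau> x y = \<tau> x' y'" and m: "m x y = m x' y'"
      using eq by (auto simp: \<tau>'_def)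
    note L = \<tau>(2)[OF xy t] and R = \<tau>(3)[OF xy t]
    \<comment> \<open>At the corner \<open>(x, y')\<close> a sender in the left zone behaves as in
      \<open>(x, y)\<close> and one in the right zone as in \<open>(x', y')\<close>; these two
      inputs send the same messages because their extended transcripts agree.\<close>
    have m': "m x y' = m x y"
    proof
      fix p
      show "m x y' p = m x y p"
      proof (cases p)
        case (Pair u v)
        show ?thesis
        proof (cases "(u, v) \<in> crossing t")
          case True
          then consider "u \<in> left t" | "u \<in> right t"
            using crossing_sender[OF assms(2)] by blast
          then show ?thesis
          proof cases
            case 1
            then show ?thesis using L by (simp add: m_def Pair)
          next
            case 2
            then have "m x y' (u, v) = m x' y' (u, v)" using R by (simp add: m_def)
            then show ?thesis using m Pair by simp
          qed
        qed (simp add: m_def Pair)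
      qed
    qed
    have "inbox B A (G x y') (S (x, y')) v = inbox B A (G x y) (S (x, y)) v" if "v \<in> left (Suc t)" for v
      using inbox_eq[OF xy(1,1,4,3) _ m'] start_left[OF xy(1,4,3)] left0 that
        edge_left[OF assms(2) xy(1,4) that] L by blast
    moreover have "inbox B A (G x y') (S (x, y')) v = inbox B A (G x' y') (S (x', y')) v"
      if "v \<in> right (Suc t)" for v
      using inbox_eq[OF xy(1,2,4,4) _ m'[unfolded m]] start_right[OF xy(1,2,4)] right0 that
        edge_right[OF assms(2) xy(1,4) that] R by blast
    ultimately show ?thesis
      using L[OF subsetD[OF left_Suc]] R[OF subsetD[OF right_Suc]]
      by (intro conjI ballI) (simp_all only: \<tau>'_def \<tau>(1)[OF xy t] m')
  qed
  have "rectangular (Suc t) \<tau>' (\<lambda>x y v. receive (inbox B A (G x y) (S (x, y)) v) (S (x, y) v))"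
    unfolding rectangular_def by (intro ballI impI) (rule 2)
  with 1 show ?thesis
    unfolding simulated_def by (intro exI[of _ \<tau>'] conjI)
qed

lemma simulated_joint_execution:
  assumes "t \<le> T" "S \<in> set_pmf (joint_execution B A V P (case_prod G) t)"
  shows "simulated ((2 ^ Suc B) ^ (K * t)) t (\<lambda>x y. S (x, y))"
  using assms
proof (induction t arbitrary: S)
  case 0
  let ?\<tau> = "\<lambda>_ _. [] :: (nat \<times> nat \<Rightarrow> bool list) list"
  have "card (case_prod ?\<tau> ` (X \<times> Y)) \<le> card {[] :: (nat \<times> nat \<Rightarrow> bool list) list}"
    by (intro card_mono) auto
  moreover have "rectangular 0 ?\<tau> (\<lambda>x y. start (G x y))"
    unfolding rectangular_def
    by (intro ballI impI conjI refl; (rule start_left start_right; assumption))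
  ultimately have "simulated 1 0 (\<lambda>x y. start (G x y))"
    unfolding simulated_def by (intro exI[of _ ?\<tau>]) simp
  then show ?case
    using simulated_joint_draw[of 1 0 "\<lambda>p. start (case_prod G p)"] 0 by simp
next
  case (Suc t)
  from Suc.prems obtain S0 where S0: "S0 \<in> set_pmf (joint_execution B A V P (case_prod G) t)"
    and S: "S \<in> set_pmf (joint_draw A V P (\<lambda>p v. receive (inbox B A (case_prod G p) (S0 p) v) (S0 p v)))"
    by auto
  show ?case
    using simulated_joint_draw[OF _ S] simulated_receive[OF Suc.IH[OF _ S0], of B A] Suc.prems(1)
    by (simp add: power_add mult_ac)
qed

section \<open>From simulated executions to correlation bounds\<close>

lemma prob_execution:
  assumes "x \<in> X" "y \<in> Y"
  shows "measure_pmf.prob (execution B A (G x y) t) {\<sigma>. \<Phi> \<sigma>} =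
    measure_pmf.expectation (joint_execution B A V (X \<times> Y) (case_prod G) t) (\<lambda>S. of_bool (\<Phi> (S (x, y))))"
proof -
  have "execution B A (G x y) t = map_pmf (\<lambda>S. S (x, y)) (joint_execution B A V (X \<times> Y) (case_prod G) t)"
    using map_pmf_joint_execution[of V "X \<times> Y" "(x, y)" "case_prod G" B A t] assms finite_V finite_X finite_Y verts_G by simp
  moreover have "(\<lambda>S. of_bool (\<Phi> (S (x, y)))) = (indicat_real {S. \<Phi> (S (x, y))} :: ('x \<times> 'y \<Rightarrow> _) \<Rightarrow> _)"
    by (auto simp: indicator_def)
  ultimately show ?thesis by (simp add: vimage_def)
qed

text \<open>For a fixed outcome \<open>S\<close>, the accepted pairs of one transcript class form a
  rectangle, so each of the at most \<open>k\<close> classes contributes at most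
  \<open>\<Delta>\<close>.\<close>

lemma sum_of_bool_simulated:
  assumes "simulated k T (\<lambda>x y. S (x, y))"
    and local: "\<And>\<sigma> \<sigma>'. (\<And>v. v \<in> left T \<Longrightarrow> \<sigma> v = \<sigma>' v) \<Longrightarrow> \<Phi> \<sigma> = \<Phi> \<sigma>'"
    and disc: "\<And>X' Y'. X' \<subseteq> X \<Longrightarrow> Y' \<subseteq> Y \<Longrightarrow> \<bar>\<Sum>x\<in>X'. \<Sum>y\<in>Y'. g x y\<bar> \<le> \<Delta>"
  shows "\<bar>\<Sum>x\<in>X. \<Sum>y\<in>Y. g x y * of_bool (\<Phi> (S (x, y)))\<bar> \<le> real k * \<Delta>"
proof -
  obtain \<tau> where card: "card (case_prod \<tau> ` (X \<times> Y)) \<le> k" and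
    rect: "rectangular T \<tau> (\<lambda>x y. S (x, y))"
    using assms(1) unfolding simulated_def by blast
  note \<tau> = rectangularD[OF rect]
  let ?h = "\<lambda>(x, y). g x y * of_bool (\<Phi> (S (x, y)))"
  let ?I = "case_prod \<tau> ` (X \<times> Y)"
  have "0 \<le> \<Delta>" using disc[of "{}" "{}"] by simp
  have cls: "\<bar>\<Sum>p\<in>{p \<in> X \<times> Y. case_prod \<tau> p = l}. ?h p\<bar> \<le> \<Delta>" if "l \<in> ?I" for l
  proof -
    \<comment> \<open>Acceptance is tested with just one partner \<open>y\<close>:
      \<open>\<Phi>\<close> reads the left zone, which \<open>x\<close> determines within a class.
      For the same reason \<open>Y'\<close> carries no acceptance condition.\<close>
    define X' where "X' = {x \<in> X. \<exists>y\<in>Y. \<tau> x y = l \<and> \<Phi> (S (x, y))}"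
    define Y' where "Y' = {y \<in> Y. \<exists>x\<in>X. \<tau> x y = l}"
    have "(\<Sum>p\<in>{p \<in> X \<times> Y. case_prod \<tau> p = l}. ?h p) =
        (\<Sum>p\<in>{p \<in> X \<times> Y. case_prod \<tau> p = l \<and> \<Phi> (S p)}. case_prod g p)"
      using finite_X finite_Y by (intro sum.mono_neutral_cong_right) auto
    also have "{p \<in> X \<times> Y. case_prod \<tau> p = l \<and> \<Phi> (S p)} = X' \<times> Y'"
    proof (intro set_eqI iffI)
      fix p assume "p \<in> {p \<in> X \<times> Y. case_prod \<tau> p = l \<and> \<Phi> (S p)}"
      then show "p \<in> X' \<times> Y'" by (auto simp: X'_def Y'_def)
    next
      fix p assume "p \<in> X' \<times> Y'"
      then obtain x y x0 y0 where p: "p = (x, y)" "x \<in> X" "y \<in> Y" "x0 \<in> X" "y0 \<in> Y"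
        "\<tau> x y0 = l" "\<Phi> (S (x, y0))" "\<tau> x0 y = l"
        by (auto simp: X'_def Y'_def)
      have t: "\<tau> x y0 = \<tau> x0 y" using p by simp
      have "\<Phi> (S (x, y)) = \<Phi> (S (x, y0))"
        by (rule local, rule \<tau>(2)[OF p(2,4,5,3) t])
      then show "p \<in> {p \<in> X \<times> Y. case_prod \<tau> p = l \<and> \<Phi> (S p)}"
        using \<tau>(1)[OF p(2,4,5,3) t] p by simp
    qed
    also have "(\<Sum>p\<in>X' \<times> Y'. case_prod g p) = (\<Sum>x\<in>X'. \<Sum>y\<in>Y'. g x y)"
      by (simp add: sum.cartesian_product)
    finally show ?thesis
      using disc[of X' Y'] by (auto simp: X'_def Y'_def)
  qed
  have "(\<Sum>x\<in>X. \<Sum>y\<in>Y. g x y * of_bool (\<Phi> (S (x, y)))) = (\<Sum>p\<in>X \<times> Y. ?h p)"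
    by (simp add: sum.cartesian_product)
  also have "\<dots> = (\<Sum>l\<in>?I. \<Sum>p\<in>{p \<in> X \<times> Y. case_prod \<tau> p = l}. ?h p)"
    using finite_X finite_Y by (intro sum.image_gen) auto
  also have "\<bar>\<dots>\<bar> \<le> (\<Sum>l\<in>?I. \<Delta>)"
    by (intro order.trans[OF sum_abs] sum_mono cls)
  also have "\<dots> \<le> real k * \<Delta>"
    using card \<open>0 \<le> \<Delta>\<close> by (simp add: mult_right_mono)
  finally show ?thesis .
qed

text \<open>The bound holds for every outcome of the joint execution, so it survives averaging over
  the coins.\<close>

theorem correlation_bound:
  assumes local: "\<And>\<sigma> \<sigma>'. (\<And>v. v \<in> left T \<Longrightarrow> \<sigma> v = \<sigma>' v) \<Longrightarrow> \<Phi> \<sigma> = \<Phi> \<sigma>'"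
    and disc: "\<And>X' Y'. X' \<subseteq> X \<Longrightarrow> Y' \<subseteq> Y \<Longrightarrow> \<bar>\<Sum>x\<in>X'. \<Sum>y\<in>Y'. g x y\<bar> \<le> \<Delta>"
  shows "\<bar>\<Sum>x\<in>X. \<Sum>y\<in>Y. g x y * measure_pmf.prob (execution B A (G x y) T) {\<sigma>. \<Phi> \<sigma>}\<bar>
    \<le> (2 ^ Suc B) ^ (K * T) * \<Delta>"
proof -
  let ?J = "joint_execution B A V (X \<times> Y) (case_prod G) T"
  let ?F = "\<lambda>S. \<Sum>x\<in>X. \<Sum>y\<in>Y. g x y * of_bool (\<Phi> (S (x, y)))"
  let ?c = "real ((2 ^ Suc B) ^ (K * T)) * \<Delta>"
  have int: "integrable (measure_pmf ?J) (\<lambda>S. of_bool (\<Phi> (S (x, y))) :: real)" for x y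
    by (intro measure_pmf.integrable_const_bound[of _ 1]) auto
  have "(\<Sum>x\<in>X. \<Sum>y\<in>Y. g x y * measure_pmf.prob (execution B A (G x y) T) {\<sigma>. \<Phi> \<sigma>}) =
      (\<Sum>x\<in>X. \<Sum>y\<in>Y. g x y * measure_pmf.expectation ?J (\<lambda>S. of_bool (\<Phi> (S (x, y)))))"
    by (intro sum.cong refl arg_cong2[of _ _ _ _ "(*)"] prob_execution)
  also have "\<dots> = measure_pmf.expectation ?J ?F"
    by (simp only: Bochner_Integration.integral_sum Bochner_Integration.integrable_sum
        integrable_mult_right int integral_mult_right_zero)
  also have "\<bar>\<dots>\<bar> \<le> ?c"
  proof -
    have bd: "\<bar>?F S\<bar> \<le> ?c" if "S \<in> set_pmf ?J" for S
      by (rule sum_of_bool_simulated[OF simulated_joint_execution[OF order.refl that] local disc])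
    have intF: "integrable (measure_pmf ?J) ?F"
      by (intro Bochner_Integration.integrable_sum integrable_mult_right int)
    show ?thesis
    proof (rule abs_leI)
      show "measure_pmf.expectation ?J ?F \<le> ?c"
      proof (intro measure_pmf.integral_le_const intF AE_pmfI)
        show "?F S \<le> ?c" if "S \<in> set_pmf ?J" for S
          by (rule abs_le_D1[OF bd[OF that]])
      qed
      have "- ?c \<le> measure_pmf.expectation ?J ?F"
      proof (intro measure_pmf.integral_ge_const intF AE_pmfI)
        show "- ?c \<le> ?F S" if "S \<in> set_pmf ?J" for S
          using abs_le_D2[OF bd[OF that]] by (subst minus_le_iff)
      qed
      then show "- measure_pmf.expectation ?J ?F \<le> ?c" by (subst minus_le_iff)
    qed
  qed
  finally show ?thesis by (simp only: of_nat_power of_nat_numeral)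
qed

text \<open>Without crossing pairs only one transcript exists, so all inputs share one class and the
  left zone evolves independently of \<open>y\<close>.\<close>

lemma prob_eq_if_no_crossing:
  assumes "K = 0" "x \<in> X" "y \<in> Y" "y' \<in> Y"
    and local: "\<And>\<sigma> \<sigma>'. (\<And>v. v \<in> left T \<Longrightarrow> \<sigma> v = \<sigma>' v) \<Longrightarrow> \<Phi> \<sigma> = \<Phi> \<sigma>'"
  shows "measure_pmf.prob (execution B A (G x y) T) {\<sigma>. \<Phi> \<sigma>} =
    measure_pmf.prob (execution B A (G x y') T) {\<sigma>. \<Phi> \<sigma>}"
proof -
  let ?J = "joint_execution B A V (X \<times> Y) (case_prod G) T"
  have "\<Phi> (S (x, y)) = \<Phi> (S (x, y'))" if "S \<in> set_pmf ?J" for S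
  proof -
    have "simulated 1 T (\<lambda>x y. S (x, y))"
      using simulated_joint_execution[OF order.refl that] assms(1) by simp
    then obtain \<tau> where card: "card (case_prod \<tau> ` (X \<times> Y)) \<le> 1" and
      rect: "rectangular T \<tau> (\<lambda>x y. S (x, y))"
      unfolding simulated_def by blast
    have "\<tau> x y = \<tau> x y'"
    proof -
      have "finite (case_prod \<tau> ` (X \<times> Y))"
        using finite_X finite_Y by simp
      moreover have "card (case_prod \<tau> ` (X \<times> Y)) \<le> Suc 0"
        using card by simp
      ultimately have eq: "\<forall>p\<in>case_prod \<tau> ` (X \<times> Y). \<forall>q\<in>case_prod \<tau> ` (X \<times> Y). p = q"
        by (rule iffD1[OF card_le_Suc0_iff_eq])
      have mem: "\<tau> x y'' \<in> case_prod \<tau> ` (X \<times> Y)" if "y'' \<in> Y" for y''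
        by (rule image_eqI[where x = "(x, y'')"]) (use assms(2) that in simp_all)
      show ?thesis
        by (rule eq[rule_format, OF mem[OF assms(3)] mem[OF assms(4)]])
    qed
    then show ?thesis
      using rectangularD(2)[OF rect assms(2,2,3,4)] by (intro local) auto
  qed
  then show ?thesis
    unfolding prob_execution[OF assms(2,3)] prob_execution[OF assms(2,4)]
    by (intro integral_cong_AE) (auto simp: AE_measure_pmf_iff)
qed

end

section \<open>Discrepancy of \<open>|x \<inter> y|\<close> modulo 3\<close>

lemma sum_Pow_insert:
  fixes f :: "'a set \<Rightarrow> 'b :: comm_monoid_add"
  assumes "finite J" "j \<notin> J"
  shows "(\<Sum>x\<in>Pow (insert j J). f x) = (\<Sum>x\<in>Pow J. f x) + (\<Sum>x\<in>Pow J. f (insert j x))"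
proof -
  have "(\<Sum>x\<in>Pow (insert j J). f x) = (\<Sum>x\<in>Pow J. f x) + (\<Sum>x\<in>insert j ` Pow J. f x)"
    unfolding Pow_insert using assms by (intro sum.union_disjoint) auto
  also have "(\<Sum>x\<in>insert j ` Pow J. f x) = (\<Sum>x\<in>Pow J. f (insert j x))"
    using assms by (intro sum.reindex_cong[of "insert j"]) (auto intro!: inj_onI)
  finally show ?thesis .
qed

definition \<omega> :: complex where "\<omega> = Complex (-1/2) (sqrt 3 / 2)"

lemma omega_square: "\<omega> * \<omega> = cnj \<omega>"
  by (simp add: \<omega>_def complex_eq_iff)

lemma omega_cnj: "\<omega> * cnj \<omega> = 1" "cnj \<omega> * \<omega> = 1"
  by (simp_all add: \<omega>_def complex_eq_iff)

lemma cmod_1_plus_omega: "cmod (1 + \<omega>) = 1" "cmod (1 + cnj \<omega>) = 1"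
  by (simp_all add: \<omega>_def cmod_def power2_eq_square)

lemma Re_omega_power: "2 * Re (\<omega> ^ k) = (if k mod 3 = 0 then 2 else - 1)"
proof -
  have c: "\<omega> ^ 3 = 1"
    by (simp add: power3_eq_cube omega_square omega_cnj)
  have "\<omega> ^ k = \<omega> ^ (3 * (k div 3) + k mod 3)"
    by simp
  also have "\<dots> = \<omega> ^ (k mod 3)"
    by (simp only: power_add power_mult c power_one mult_1_left)
  finally have "\<omega> ^ k = \<omega> ^ (k mod 3)" .
  moreover have "k mod 3 = 0 \<or> k mod 3 = 1 \<or> k mod 3 = 2" by linarith
  moreover have "\<omega> ^ 2 = cnj \<omega>"
    by (simp add: power2_eq_square omega_square)
  moreover have "Re \<omega> = - 1 / 2" by (simp add: \<omega>_def)
  ultimately show ?thesis by auto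
qed

text \<open>The matrix is a tensor power of the 2 by 2 matrix with rows \<open>1, 1\<close> and
  \<open>1, \<omega>\<close>. The Gram matrix of one factor has 2 on the diagonal and entries of
  modulus 1 off it, so each element of \<open>J\<close> multiplies the absolute row sum by
  3.\<close>

lemma sum_cmod_character_sums:
  assumes "finite J" "y \<subseteq> J"
  shows "(\<Sum>y'\<in>Pow J. cmod (\<Sum>x\<in>Pow J. \<omega> ^ card (x \<inter> y) * cnj (\<omega> ^ card (x \<inter> y')))) \<le> 3 ^ card J"
  using assms
proof (induction J arbitrary: y rule: finite_induct)
  case empty
  then show ?case by simp
next
  case (insert j J)
  define S where "S y y' = (\<Sum>x\<in>Pow J. \<omega> ^ card (x \<inter> y) * cnj (\<omega> ^ card (x \<inter> y')))" for y y'
  have card_ins: "card (insert j x \<inter> insert j y) = Suc (card (x \<inter> y))"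
    "card (insert j (x \<inter> y)) = Suc (card (x \<inter> y))"
    "card (insert j x \<inter> y) = card (x \<inter> y)" "card (x \<inter> insert j y) = card (x \<inter> y)"
    if "x \<subseteq> J" "y \<subseteq> J" for x y
  proof -
    have "finite (x \<inter> y)" "j \<notin> x \<inter> y" using that insert.hyps finite_subset by blast+
    moreover have "insert j x \<inter> insert j y = insert j (x \<inter> y)" by blast
    ultimately show "card (insert j x \<inter> insert j y) = Suc (card (x \<inter> y))"
      "card (insert j (x \<inter> y)) = Suc (card (x \<inter> y))" by simp_all
    have "insert j x \<inter> y = x \<inter> y" "x \<inter> insert j y = x \<inter> y" using that insert.hyps by auto
    then show "card (insert j x \<inter> y) = card (x \<inter> y)" "card (x \<inter> insert j y) = card (x \<inter> y)" by simp_all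
  qed
  let ?y = "y - {j}"
  have y: "?y \<subseteq> J" "y = (if j \<in> y then insert j ?y else ?y)"
    using insert.prems by auto
  have IH: "(\<Sum>y'\<in>Pow J. cmod (S ?y y')) \<le> 3 ^ card J"
    unfolding S_def using insert.IH[OF y(1)] .
  \<comment> \<open>Splitting off \<open>j\<close> multiplies each inner sum by an entry of the Gram
    matrix of one factor: 2 if \<open>z\<close> and \<open>y'\<close> agree about \<open>j\<close>,
    a number of modulus 1 otherwise.\<close>
  have *: "(\<Sum>y'\<in>Pow (insert j J). cmod (\<Sum>x\<in>Pow (insert j J). \<omega> ^ card (x \<inter> z) * cnj (\<omega> ^ card (x \<inter> y'))))
      = 3 * (\<Sum>y'\<in>Pow J. cmod (S w y'))" if w: "w \<subseteq> J" and z: "z = w \<or> z = insert j w" for w z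
  proof -
    have "(\<Sum>x\<in>Pow (insert j J). \<omega> ^ card (x \<inter> z) * cnj (\<omega> ^ card (x \<inter> y'))) =
        S w y' * (if z = w then 2 else 1 + \<omega>)" if "y' \<subseteq> J" for y'
    proof -
      have "w \<noteq> insert j w" using w insert.hyps by auto
      then show ?thesis
        using z w that insert.hyps
        by (auto simp: omega_cnj sum_Pow_insert card_ins S_def algebra_simps sum_distrib_left sum_distrib_right simp flip: sum.distrib
            intro!: sum.cong)
    qed
    moreover have "(\<Sum>x\<in>Pow (insert j J). \<omega> ^ card (x \<inter> z) * cnj (\<omega> ^ card (x \<inter> insert j y'))) =
        S w y' * (if z = w then 1 + cnj \<omega> else 2)" if "y' \<subseteq> J" for y'
    proof -
      have "w \<noteq> insert j w" using w insert.hyps by auto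
      moreover have "\<omega> * (cnj \<omega> * a) = a" for a
        using omega_cnj(1) by (simp flip: mult.assoc)
      ultimately show ?thesis
        using z w that insert.hyps
        by (auto simp: omega_cnj sum_Pow_insert card_ins S_def algebra_simps sum_distrib_left sum_distrib_right simp flip: sum.distrib
            intro!: sum.cong)
    qed
    ultimately show ?thesis
      using insert.hyps
      by (auto simp: sum_Pow_insert norm_mult cmod_1_plus_omega sum_distrib_left simp flip: sum.distrib intro!: sum.cong)
  qed
  show ?case
    using *[OF y(1), of y] y(2) IH insert.hyps by (auto split: if_splits)
qed

text \<open>Cauchy-Schwarz over \<open>x\<close> and extending \<open>X'\<close> to
  \<open>Pow J\<close> leave sums of Gram matrix entries, controlled by the absolute row sums. The
  trivial bound would be \<open>16 ^ card J\<close>.\<close>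

lemma cmod_character_rectangle:
  assumes "finite J" "X' \<subseteq> Pow J" "Y' \<subseteq> Pow J"
  shows "(cmod (\<Sum>x\<in>X'. \<Sum>y\<in>Y'. \<omega> ^ card (x \<inter> y)))\<^sup>2 \<le> 12 ^ card J"
proof -
  have fin: "finite X'" "finite Y'"
    using assms finite_subset[OF _ finite_Pow_iff[THEN iffD2, OF assms(1)]] by blast+
  define c where "c x = (\<Sum>y\<in>Y'. \<omega> ^ card (x \<inter> y))" for x
  let ?S = "\<lambda>y y'. \<Sum>x\<in>Pow J. \<omega> ^ card (x \<inter> y) * cnj (\<omega> ^ card (x \<inter> y'))"
  have cards: "card X' \<le> 2 ^ card J" "card Y' \<le> 2 ^ card J"
    using card_mono[OF _ assms(2)] card_mono[OF _ assms(3)] assms(1) by (simp_all add: card_Pow)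
  have rcards: "real (card X') \<le> 2 ^ card J" "real (card Y') \<le> 2 ^ card J"
    using cards[THEN of_nat_mono, where 'a = real] by simp_all
  have "(cmod (\<Sum>x\<in>X'. c x))\<^sup>2 \<le> (\<Sum>x\<in>X'. cmod (c x))\<^sup>2"
    by (intro power_mono norm_sum) auto
  also have "\<dots> \<le> of_nat (card X') * (\<Sum>x\<in>X'. (cmod (c x))\<^sup>2)"
    using sum_squared_le_sum_of_squares[of "\<lambda>x. cmod (c x)" X'] by (simp add: mult.commute)
  also have "\<dots> \<le> 2 ^ card J * (\<Sum>x\<in>Pow J. (cmod (c x))\<^sup>2)"
  proof (intro mult_mono sum_mono2)
    show "real (card X') \<le> 2 ^ card J" by (rule rcards)
  qed (use assms in \<open>auto intro: sum_nonneg\<close>)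
  also have "(\<Sum>x\<in>Pow J. (cmod (c x))\<^sup>2) \<le> 2 ^ card J * 3 ^ card J"
  proof -
    have "complex_of_real (\<Sum>x\<in>Pow J. (cmod (c x))\<^sup>2) = (\<Sum>x\<in>Pow J. c x * cnj (c x))"
      by (simp only: of_real_sum complex_norm_square)
    also have "\<dots> = (\<Sum>x\<in>Pow J. \<Sum>y\<in>Y'. \<Sum>y'\<in>Y'. \<omega> ^ card (x \<inter> y) * cnj (\<omega> ^ card (x \<inter> y')))"
      by (simp add: c_def sum_product)
    also have "\<dots> = (\<Sum>y\<in>Y'. \<Sum>x\<in>Pow J. \<Sum>y'\<in>Y'. \<omega> ^ card (x \<inter> y) * cnj (\<omega> ^ card (x \<inter> y')))"
      by (rule sum.swap)
    also have "\<dots> = (\<Sum>y\<in>Y'. \<Sum>y'\<in>Y'. ?S y y')"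
      by (intro sum.cong refl sum.swap)
    finally have eq: "complex_of_real (\<Sum>x\<in>Pow J. (cmod (c x))\<^sup>2) = (\<Sum>y\<in>Y'. \<Sum>y'\<in>Y'. ?S y y')" .
    have nn: "0 \<le> (\<Sum>x\<in>Pow J. (cmod (c x))\<^sup>2)" by (intro sum_nonneg) simp
    have "(\<Sum>x\<in>Pow J. (cmod (c x))\<^sup>2) = cmod (complex_of_real (\<Sum>x\<in>Pow J. (cmod (c x))\<^sup>2))"
      by (simp only: norm_of_real abs_of_nonneg[OF nn])
    also have "\<dots> = cmod (\<Sum>y\<in>Y'. \<Sum>y'\<in>Y'. ?S y y')" by (simp only: eq)
    also have "\<dots> \<le> (\<Sum>y\<in>Y'. \<Sum>y'\<in>Y'. cmod (?S y y'))"
      by (intro order.trans[OF norm_sum] sum_mono norm_sum)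
    also have "\<dots> \<le> (\<Sum>y\<in>Y'. \<Sum>y'\<in>Pow J. cmod (?S y y'))"
      using assms by (intro sum_mono sum_mono2) auto
    also have "\<dots> \<le> (\<Sum>y\<in>Y'. 3 ^ card J)"
      using assms by (intro sum_mono sum_cmod_character_sums) auto
    also have "\<dots> \<le> 2 ^ card J * 3 ^ card J"
      using rcards(2) by simp
    finally show ?thesis .
  qed
  finally have "(cmod (\<Sum>x\<in>X'. c x))\<^sup>2 \<le> 2 ^ card J * (2 ^ card J * 3 ^ card J)"
    by (simp add: mult_left_mono)
  also have "\<dots> = 12 ^ card J"
    by (simp flip: power_mult_distrib)
  finally show ?thesis unfolding c_def .
qed

text \<open>The weight \<open>\<omega>\<^sup>s + \<omega>\<^bsup>-s\<^esup>\<close> with \<open>s = |x \<inter> y|\<close>, so that character sums bound its sum over a rectangle.\<close>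

definition mod3_sign :: "'a set \<Rightarrow> 'a set \<Rightarrow> real" where
  "mod3_sign x y = (if card (x \<inter> y) mod 3 = 0 then 2 else - 1)"

lemma mod3_sign_rectangle:
  assumes "finite J" "X' \<subseteq> Pow J" "Y' \<subseteq> Pow J"
  shows "\<bar>\<Sum>x\<in>X'. \<Sum>y\<in>Y'. mod3_sign x y\<bar> \<le> 2 * (7 / 2) ^ card J"
proof -
  let ?c = "\<Sum>x\<in>X'. \<Sum>y\<in>Y'. \<omega> ^ card (x \<inter> y)"
  have "(cmod ?c)\<^sup>2 \<le> 12 ^ card J"
    by (rule cmod_character_rectangle[OF assms])
  \<comment> \<open>The rational 7/2 replaces the square root of 12; being below 4, it keeps the
    bound exponentially smaller than the number of pairs.\<close>
  also have "\<dots> \<le> ((7 / 2) ^ 2) ^ card J"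
    by (intro power_mono) (auto simp: power2_eq_square)
  also have "\<dots> = ((7 / 2) ^ card J)\<^sup>2"
    by (simp only: mult.commute flip: power_mult)
  finally have "cmod ?c \<le> (7 / 2) ^ card J"
    by (rule power2_le_imp_le) simp
  moreover have "(\<Sum>x\<in>X'. \<Sum>y\<in>Y'. mod3_sign x y) = 2 * Re ?c"
    by (simp add: mod3_sign_def sum_distrib_left flip: Re_omega_power)
  moreover have "\<bar>Re ?c\<bar> \<le> cmod ?c" by (rule abs_Re_le_cmod)
  ultimately show ?thesis by linarith
qed

text \<open>The advantage \<open>1 - 2 * \<epsilon>\<close> forces a correlation proportional to
  \<open>4 ^ card J\<close>, while \<open>corr\<close> allows only a constant times
  \<open>L * (7 / 2) ^ card J\<close>.\<close>

lemma mod3_decider_correlation: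
  assumes "finite J" "0 \<le> \<epsilon>" "\<epsilon> < 1 / 2"
    and yes: "\<And>x y. x \<subseteq> J \<Longrightarrow> y \<subseteq> J \<Longrightarrow> card (x \<inter> y) mod 3 = 0 \<Longrightarrow> f x y \<ge> 1 - \<epsilon>"
    and no: "\<And>x y. x \<subseteq> J \<Longrightarrow> y \<subseteq> J \<Longrightarrow> card (x \<inter> y) mod 3 \<noteq> 0 \<Longrightarrow> f x y \<le> \<epsilon>"
    and corr: "\<bar>\<Sum>x\<in>Pow J. \<Sum>y\<in>Pow J. mod3_sign x y * f x y\<bar> \<le> L * (2 * (7 / 2) ^ card J)"
    and "L \<ge> 1"
  shows "(1 - 2 * \<epsilon>) / 6 \<le> L * (7 / 8) ^ card J"
proof -
  let ?E = "\<Sum>x\<in>Pow J. \<Sum>y\<in>Pow J. mod3_sign x y"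
  \<comment> \<open>An affine function of the sign, tight in both worst cases: value
    \<open>1 - \<epsilon>\<close> at sign 2 and \<open>\<epsilon>\<close> at sign -1. Its constant
    term survives summation because the signs nearly cancel.\<close>
  have pt: "mod3_sign x y * f x y \<ge> (2 - \<epsilon>) / 3 * mod3_sign x y + 2 / 3 * (1 - 2 * \<epsilon>)"
    if "x \<subseteq> J" "y \<subseteq> J" for x y
    using yes[OF that] no[OF that] by (auto simp: mod3_sign_def field_simps)
  have "(\<Sum>x\<in>Pow J. \<Sum>y\<in>Pow J. mod3_sign x y * f x y) \<ge>
      (\<Sum>x\<in>Pow J. \<Sum>y\<in>Pow J. (2 - \<epsilon>) / 3 * mod3_sign x y + 2 / 3 * (1 - 2 * \<epsilon>))"
    by (intro sum_mono pt) auto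
  also have "(\<Sum>x\<in>Pow J. \<Sum>y\<in>Pow J. (2 - \<epsilon>) / 3 * mod3_sign x y + 2 / 3 * (1 - 2 * \<epsilon>)) =
      (2 - \<epsilon>) / 3 * ?E + 2 / 3 * (1 - 2 * \<epsilon>) * 4 ^ card J"
  proof -
    have "(4::real) ^ card J = 2 ^ card J * 2 ^ card J"
      by (simp flip: power_mult_distrib)
    then show ?thesis
      using assms(1) by (simp add: sum.distrib sum_distrib_left card_Pow)
  qed
  finally have 1: "(2 - \<epsilon>) / 3 * ?E + 2 / 3 * (1 - 2 * \<epsilon>) * 4 ^ card J \<le> L * (2 * (7 / 2) ^ card J)"
    using corr by linarith
  have E: "\<bar>?E\<bar> \<le> 2 * (7 / 2) ^ card J"
    by (rule mod3_sign_rectangle) (use assms(1) in auto)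
  have "\<bar>(2 - \<epsilon>) / 3 * ?E\<bar> \<le> 2 / 3 * (2 * (7 / 2) ^ card J)"
    unfolding abs_mult using assms(2,3) E by (intro mult_mono) auto
  also have "\<dots> \<le> L * (2 * (7 / 2) ^ card J)"
    using assms(7) by (intro mult_right_mono) auto
  finally have "2 / 3 * (1 - 2 * \<epsilon>) * 4 ^ card J \<le> 2 * (L * (2 * (7 / 2) ^ card J))"
    using 1 by linarith
  then have "(1 - 2 * \<epsilon>) / 6 * 4 ^ card J \<le> L * (7 / 2) ^ card J" by argo
  then have "(1 - 2 * \<epsilon>) / 6 \<le> L * (7 / 2) ^ card J / 4 ^ card J"
    by (simp add: field_simps)
  also have "\<dots> = L * ((7 / 2) / 4) ^ card J"
    by (simp only: power_divide times_divide_eq_right)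
  also have "(7 / 2) / 4 = (7 / 8 :: real)"
    by simp
  finally show ?thesis .
qed

section \<open>Cuts and hop diameter\<close>

lemma prob_le_if_disjoint:
  assumes "measure_pmf.prob p S \<ge> 1 - \<epsilon>" "\<And>\<sigma>. \<sigma> \<in> S \<Longrightarrow> \<not> \<Phi> \<sigma>"
  shows "measure_pmf.prob p {\<sigma>. \<Phi> \<sigma>} \<le> \<epsilon>"
proof -
  have "measure_pmf.prob p S + measure_pmf.prob p {\<sigma>. \<Phi> \<sigma>} = measure_pmf.prob p (S \<union> {\<sigma>. \<Phi> \<sigma>})"
    using assms(2) by (intro measure_pmf.finite_measure_Union[symmetric]) auto
  also have "\<dots> \<le> 1" by simp
  finally show ?thesis using assms(1) by linarith
qed

lemma prob_ge_if_implied: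
  assumes "measure_pmf.prob p S \<ge> 1 - \<epsilon>" "\<And>\<sigma>. \<sigma> \<in> S \<Longrightarrow> \<Phi> \<sigma>"
  shows "measure_pmf.prob p {\<sigma>. \<Phi> \<sigma>} \<ge> 1 - \<epsilon>"
  using assms(1) measure_pmf.finite_measure_mono[of S "{\<sigma>. \<Phi> \<sigma>}" p] assms(2) by fastforce

lemma approximates_connectivityD:
  "approximates_connectivity B \<alpha> \<epsilon> \<G> T A \<Longrightarrow> G \<in> \<G> \<Longrightarrow>
    measure_pmf.prob (execution B A G T)
      {\<sigma>. \<forall>v\<in>verts G. answer A (\<sigma> v) \<in> {edge_connectivity G .. \<alpha> * edge_connectivity G}} \<ge> 1 - \<epsilon>"
  unfolding approximates_connectivity_def by blast

lemma computes_min_cutD: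
  "computes_min_cut_knowing_connectivity B \<alpha> \<epsilon> \<G> T A \<Longrightarrow> G \<in> \<G> \<Longrightarrow> edge_connectivity G = w \<Longrightarrow>
    measure_pmf.prob (execution B (A w) G T)
      {\<sigma>. approx_min_cut \<alpha> G {v \<in> verts G. answer (A w) (\<sigma> v)}} \<ge> 1 - \<epsilon>"
  unfolding computes_min_cut_knowing_connectivity_def Let_def by blast

section \<open>Cut weights and edge connectivity\<close>

lemma card_doubleton_Int_eq_1:
  "u \<noteq> v \<Longrightarrow> card ({u, v} \<inter> C) = 1 \<longleftrightarrow> (u \<in> C) \<noteq> (v \<in> C)"
  by (cases "u \<in> C"; cases "v \<in> C") auto

lemma weighted_graph_edgeD:
  assumes "weighted_graph G" "{u, v} \<in> edges G"
  shows "u \<in> verts G" "v \<in> verts G" "u \<noteq> v"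
  using assms unfolding weighted_graph_def by (force simp: card_insert_if split: if_splits)+

lemma finite_edges: "weighted_graph G \<Longrightarrow> finite (edges G)"
  unfolding weighted_graph_def by (meson Pow_iff finite_Pow_iff finite_subset subsetI)

lemma cut_weight_ge_sum:
  assumes "weighted_graph G" "F \<subseteq> edges G" "\<And>e. e \<in> F \<Longrightarrow> card (e \<inter> C) = 1"
  shows "sum (weight G) F \<le> cut_weight G C"
  unfolding cut_weight_def
  using assms finite_edges[OF assms(1)] by (intro sum_mono2) (auto simp: weighted_graph_def intro: order.trans[of 0 1])

lemma weight_le_cut_weight:
  assumes "weighted_graph G" "{u, v} \<in> edges G" "(u \<in> C) \<noteq> (v \<in> C)"
  shows "weight G {u, v} \<le> cut_weight G C"
  using cut_weight_ge_sum[OF assms(1), of "{{u, v}}" C] assms card_doubleton_Int_eq_1[of u v C] by auto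

lemma finite_proper_sides: "weighted_graph G \<Longrightarrow> finite {C. proper_side G C}"
  by (rule finite_subset[of _ "Pow (verts G)"]) (auto simp: proper_side_def weighted_graph_def)

lemma edge_connectivity_le:
  "weighted_graph G \<Longrightarrow> proper_side G C \<Longrightarrow> edge_connectivity G \<le> cut_weight G C"
  unfolding edge_connectivity_def using finite_proper_sides by (intro Min_le) auto

lemma edge_connectivity_ge:
  assumes "weighted_graph G" "proper_side G C0" "\<And>C. proper_side G C \<Longrightarrow> w \<le> cut_weight G C"
  shows "w \<le> edge_connectivity G"
  unfolding edge_connectivity_def using finite_proper_sides[OF assms(1)] assms(2,3)
  by (subst Min_ge_iff) auto

section \<open>Walks and hop diameter\<close>

lemma adjacency_iff: "(u, v) \<in> adjacency G \<longleftrightarrow> {u, v} \<in> edges G"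
  by (simp add: adjacency_def)

lemma adjacency_relpow_sym: "(u, v) \<in> adjacency G ^^ k \<Longrightarrow> (v, u) \<in> adjacency G ^^ k"
proof (induction k arbitrary: v)
  case (Suc k)
  then obtain w where "(u, w) \<in> adjacency G ^^ k" "(v, w) \<in> adjacency G"
    by (auto simp: adjacency_iff insert_commute)
  then show ?case using Suc.IH relpow_Suc_I2 by metis
qed simp

text \<open>\<open>f\<close> is a potential growing by at most one per edge, so every walk from
  \<open>a\<close> to \<open>b\<close> has at least \<open>D\<close> steps; \<open>reach\<close> is
  the matching upper bound.\<close>

lemma hop_diameter_eq:
  fixes f :: "nat \<Rightarrow> nat"
  assumes "finite (verts G)"
    and reach: "\<And>u v. u \<in> verts G \<Longrightarrow> v \<in> verts G \<Longrightarrow> \<exists>k\<le>D. (u, v) \<in> adjacency G ^^ k"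
    and lip: "\<And>u v. {u, v} \<in> edges G \<Longrightarrow> f v \<le> f u + 1"
    and ab: "a \<in> verts G" "b \<in> verts G" "f a + D \<le> f b"
  shows "hop_diameter G = D"
proof -
  have fin: "finite {hop_dist G u v | u v. u \<in> verts G \<and> v \<in> verts G}"
    using finite_image_set2[of "\<lambda>u. u \<in> verts G" "\<lambda>v. v \<in> verts G" "hop_dist G"] assms(1) by simp
  have le: "hop_dist G u v \<le> D" if "u \<in> verts G" "v \<in> verts G" for u v
    using reach[OF that] unfolding hop_dist_def by (meson Least_le order.trans)
  have walk: "f v \<le> f a + k" if "(a, v) \<in> adjacency G ^^ k" for k v
    using that
  proof (induction k arbitrary: v)
    case (Suc k)
    then obtain w where "(a, w) \<in> adjacency G ^^ k" "{w, v} \<in> edges G"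
      by (auto simp: adjacency_iff)
    then show ?case using Suc.IH[of w] lip[of w v] by simp
  qed simp
  have "(a, b) \<in> adjacency G ^^ hop_dist G a b"
    unfolding hop_dist_def using reach[OF ab(1,2)] by (metis LeastI)
  then have "D \<le> hop_dist G a b"
    using walk ab(3) by fastforce
  then have "hop_dist G a b = D" using le[OF ab(1,2)] by simp
  then show ?thesis
    unfolding hop_diameter_def using le ab fin by (intro Max_eqI) auto
qed

text \<open>Reaching the centre costs at most \<open>D - D div 2\<close> and going on to an off-path
  vertex at most \<open>D div 2\<close>, together \<open>D\<close>; two path vertices are joined
  along the path. Both graph families below have this shape.\<close>

lemma hop_diameter_path_with_centre:
  assumes V: "verts G = {..<n}" and D: "D < n"
    and path: "\<And>i. i < D \<Longrightarrow> {i, Suc i} \<in> edges G"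
    and near: "\<And>v. D < v \<Longrightarrow> v < n \<Longrightarrow> \<exists>k\<le>D div 2. (D div 2, v) \<in> adjacency G ^^ k"
    and inner: "\<And>u v. {u, v} \<in> edges G \<Longrightarrow> u \<le> D \<Longrightarrow> v \<le> D \<Longrightarrow> v = Suc u \<or> u = Suc v"
    and outer: "\<And>u v. {u, v} \<in> edges G \<Longrightarrow> u \<le> D \<Longrightarrow> D < v \<Longrightarrow> u = D div 2"
  shows "connected_graph G" and "hop_diameter G = D"
proof -
  have walk: "(i, i + k) \<in> adjacency G ^^ k" if "i + k \<le> D" for i k
    using that
  proof (induction k)
    case (Suc k)
    then show ?case using path[of "i + k"] by (auto simp: adjacency_iff intro: relpow_Suc_I)
  qed simp
  have pp: "\<exists>k\<le>D. (u, v) \<in> adjacency G ^^ k" if "u \<le> v" "v \<le> D" for u v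
    using walk[of u "v - u"] that by (intro exI[of _ "v - u"]) auto
  have pc: "\<exists>k\<le>D - D div 2. (u, D div 2) \<in> adjacency G ^^ k" if "u \<le> D" for u
  proof (cases "u \<le> D div 2")
    case True
    then show ?thesis using walk[of u "D div 2 - u"] by (intro exI[of _ "D div 2 - u"]) auto
  next
    case False
    then show ?thesis using adjacency_relpow_sym[OF walk[of "D div 2" "u - D div 2"]] that
      by (intro exI[of _ "u - D div 2"]) auto
  qed
  have half: "\<exists>k\<le>D - D div 2. (u, D div 2) \<in> adjacency G ^^ k" if u: "u < n" for u
  proof (cases "u \<le> D")
    case False
    then obtain k where "k \<le> D div 2" "(D div 2, u) \<in> adjacency G ^^ k" using near[of u] u by auto
    then show ?thesis using adjacency_relpow_sym by (intro exI[of _ k]) auto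
  qed (use pc in auto)
  have reach: "\<exists>k\<le>D. (u, v) \<in> adjacency G ^^ k" if "u < n" "v < n" for u v
  proof -
    have *: "\<exists>k\<le>D. (u, v) \<in> adjacency G ^^ k" if uv: "u < n" "v < n" "D < v" for u v
    proof -
      obtain k l where "k \<le> D - D div 2" "(u, D div 2) \<in> adjacency G ^^ k"
        "l \<le> D div 2" "(D div 2, v) \<in> adjacency G ^^ l"
        using half[OF uv(1)] near[OF uv(3,2)] by blast
      then have "(u, v) \<in> adjacency G ^^ (k + l)" "k + l \<le> D"
        by (auto simp: relpow_add)
      then show ?thesis by blast
    qed
    consider "D < v" | "D < u" | "u \<le> v" "v \<le> D" | "v \<le> u" "u \<le> D" by linarith
    then show ?thesis
    proof cases
      case 1
      then show ?thesis using * that by blast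
    next
      case 2
      then show ?thesis using *[OF that(2,1)] adjacency_relpow_sym by blast
    next
      case 3
      then show ?thesis by (rule pp)
    next
      case 4
      then show ?thesis using pp[of v u] adjacency_relpow_sym by blast
    qed
  qed
  show "connected_graph G"
    unfolding connected_graph_def V using reach relpow_imp_rtrancl by (metis lessThan_iff)
  show "hop_diameter G = D"
  \<comment> \<open>The potential is the position on the path, with all other vertices collapsed to
    the centre.\<close>
  proof (rule hop_diameter_eq[where a = 0 and b = D and f = "\<lambda>v. if v \<le> D then v else D div 2"])
    show "(if v \<le> D then v else D div 2) \<le> (if u \<le> D then u else D div 2) + 1"
      if "{u, v} \<in> edges G" for u v
      using inner[OF that] outer[OF that] outer[of v u] that by (auto simp: insert_commute)
  qed (use V D reach in auto)
qed

section \<open>The bound in terms of the diameter\<close>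

text \<open>The light edge \<open>{p, p + 1}\<close> is absent if \<open>p = D\<close>.\<close>

definition broom :: "nat \<Rightarrow> nat \<Rightarrow> real \<Rightarrow> nat \<Rightarrow> wgraph" where
  "broom D n M p =
     \<lparr>verts = {..<n},
      edges = {{i, Suc i} | i. i < D} \<union> {{D div 2, j} | j. D < j \<and> j < n},
      weight = (\<lambda>e. if e = {p, Suc p} then 1 else M)\<rparr>"

locale broom_graph =
  fixes D n :: nat and M :: real
  assumes D4: "4 \<le> D" and Dn: "D < n" and M: "1 < M"
begin

lemma verts_broom [simp]: "verts (broom D n M p) = {..<n}"
  by (simp add: broom_def)

lemma edges_broom: "{u, v} \<in> edges (broom D n M p) \<longleftrightarrow>
    u < D \<and> v = Suc u \<or> v < D \<and> u = Suc v \<or>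
    u = D div 2 \<and> D < v \<and> v < n \<or> v = D div 2 \<and> D < u \<and> u < n"
  by (auto simp: broom_def doubleton_eq_iff)

lemma weight_broom: "weight (broom D n M p) e = (if e = {p, Suc p} then 1 else M)"
  by (simp add: broom_def)

lemma weighted_broom: "weighted_graph (broom D n M p)"
  using D4 Dn M by (auto simp: weighted_graph_def broom_def)

lemma broom_inputs: "M \<in> W \<Longrightarrow> 1 \<in> W \<Longrightarrow> broom D n M p \<in> inputs W n D"
proof -
  assume W: "M \<in> W" "1 \<in> W"
  have near: "\<exists>k\<le>D div 2. (D div 2, v) \<in> adjacency (broom D n M p) ^^ k" if "D < v" "v < n" for v
    using that D4 by (intro exI[of _ 1]) (auto simp: adjacency_iff edges_broom)
  have path: "{i, Suc i} \<in> edges (broom D n M p)" if "i < D" for i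
    using that by (simp add: edges_broom)
  have inner: "v = Suc u \<or> u = Suc v" if "{u, v} \<in> edges (broom D n M p)" "u \<le> D" "v \<le> D" for u v
    using that by (auto simp: edges_broom)
  have outer: "u = D div 2" if "{u, v} \<in> edges (broom D n M p)" "u \<le> D" "D < v" for u v
    using that by (auto simp: edges_broom)
  have "connected_graph (broom D n M p)" "hop_diameter (broom D n M p) = D"
    by (rule hop_diameter_path_with_centre[OF verts_broom Dn path near inner outer]; assumption)+
  then show ?thesis
    unfolding inputs_def using W by (auto simp: weighted_broom weight_broom)
qed

text \<open>A cut below \<open>M\<close> crosses no heavy edge, so membership is constant on the
  components left without the light edge. As the cut is proper, there must be two of them, on
  opposite sides.\<close>

lemma cut_broom:
  assumes C: "proper_side (broom D n M p) C" and light: "cut_weight (broom D n M p) C < M"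
  shows "p < D" and "i \<le> p \<Longrightarrow> i \<in> C \<longleftrightarrow> 0 \<in> C" and "p < i \<Longrightarrow> i \<le> D \<Longrightarrow> i \<in> C \<longleftrightarrow> 0 \<notin> C"
proof -
  have eq: "u \<in> C \<longleftrightarrow> v \<in> C" if "{u, v} \<in> edges (broom D n M p)" "{u, v} \<noteq> {p, Suc p}" for u v
    using weight_le_cut_weight[OF weighted_broom that(1), of C] light that(2) by (auto simp: weight_broom)
  have step: "i \<in> C \<longleftrightarrow> Suc i \<in> C" if "i < D" "i \<noteq> p" for i
    using that by (intro eq) (auto simp: edges_broom doubleton_eq_iff)
  have low: "i \<in> C \<longleftrightarrow> 0 \<in> C" if "i \<le> p" "i \<le> D" for i
    using that by (induction i) (use step in auto)
  have high: "D - k \<in> C \<longleftrightarrow> D \<in> C" if "p < D - k" for k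
    using that
  proof (induction k)
    case (Suc k)
    then show ?case using step[of "D - Suc k"] by (simp add: Suc_diff_Suc)
  qed simp
  have high': "i \<in> C \<longleftrightarrow> D \<in> C" if "p < i" "i \<le> D" for i
    using high[of "D - i"] that by simp
  have leaf: "j \<in> C \<longleftrightarrow> D div 2 \<in> C" if "D < j" "j < n" for j
    using that D4 by (intro eq) (auto simp: edges_broom doubleton_eq_iff)
  have sep: "p < D \<and> (D \<in> C \<longleftrightarrow> 0 \<notin> C)"
  proof (rule ccontr)
    assume "\<not> (p < D \<and> (D \<in> C \<longleftrightarrow> 0 \<notin> C))"
    then have on_path: "i \<in> C \<longleftrightarrow> 0 \<in> C" if "i \<le> D" for i
      using low[of i] high'[of i] low[of D] that by (cases "i \<le> p"; cases "p < D") auto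
    have "i \<in> C \<longleftrightarrow> 0 \<in> C" if "i < n" for i
    proof (cases "i \<le> D")
      case True
      then show ?thesis by (rule on_path)
    next
      case False
      then have "i \<in> C \<longleftrightarrow> D div 2 \<in> C" by (intro leaf that) simp
      also have "\<dots> \<longleftrightarrow> 0 \<in> C" by (rule on_path) simp
      finally show ?thesis .
    qed
    then have "C = {} \<or> {..<n} \<subseteq> C" using C unfolding proper_side_def verts_broom by blast
    then show False using C unfolding proper_side_def verts_broom by blast
  qed
  show pD: "p < D" by (rule conjunct1[OF sep])
  show "i \<in> C \<longleftrightarrow> 0 \<in> C" if "i \<le> p"
    by (rule low[OF that]) (use that pD in simp)
  show "i \<in> C \<longleftrightarrow> 0 \<notin> C" if "p < i" "i \<le> D"
    using high'[OF that] conjunct2[OF sep] by simp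
qed

lemma proper_side_singleton: "proper_side (broom D n M p) {0}"
proof -
  have "D \<in> {..<n}" "D \<notin> {0}" "0 \<in> {..<n}" using D4 Dn by auto
  then show ?thesis unfolding proper_side_def verts_broom by blast
qed

lemma edge_connectivity_broom_heavy: "D \<le> p \<Longrightarrow> M \<le> edge_connectivity (broom D n M p)"
  using cut_broom(1) by (intro edge_connectivity_ge[OF weighted_broom proper_side_singleton]) force

lemma edge_connectivity_broom_light:
  assumes "p < D"
  shows "edge_connectivity (broom D n M p) = 1"
proof (rule antisym)
  \<comment> \<open>Leaves are counted at the position of the centre, so only the light edge leaves
    this set.\<close>
  define C where "C = {v. v < n \<and> (if v \<le> D then v else D div 2) \<le> p}"
  have C: "proper_side (broom D n M p) C"
  proof -
    have "0 \<in> C" "D \<notin> C" "C \<subseteq> {..<n}" using assms Dn by (auto simp: C_def)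
    then show ?thesis using Dn unfolding proper_side_def by auto
  qed
  have "{e \<in> edges (broom D n M p). card (e \<inter> C) = 1} \<subseteq> {{p, Suc p}}"
  proof
    fix e assume e: "e \<in> {e \<in> edges (broom D n M p). card (e \<inter> C) = 1}"
    then obtain u v where uv: "e = {u, v}" "{u, v} \<in> edges (broom D n M p)"
      by (auto simp: broom_def)
    then have "(u \<in> C) \<noteq> (v \<in> C)"
      using e card_doubleton_Int_eq_1[of u v C] weighted_graph_edgeD[OF weighted_broom uv(2)] by auto
    with uv(2) have "{u, v} = {p, Suc p}"
      using Dn by (auto simp: edges_broom C_def doubleton_eq_iff split: if_splits)
    then show "e \<in> {{p, Suc p}}" using uv by simp
  qed
  then have "cut_weight (broom D n M p) C \<le> (\<Sum>e\<in>{{p, Suc p}}. weight (broom D n M p) e)"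
    unfolding cut_weight_def using M by (intro sum_mono2) (auto simp: weight_broom)
  then show "edge_connectivity (broom D n M p) \<le> 1"
    using edge_connectivity_le[OF weighted_broom C] by (simp add: weight_broom)
  show "1 \<le> edge_connectivity (broom D n M p)"
  proof (rule edge_connectivity_ge[OF weighted_broom proper_side_singleton])
    fix C assume C: "proper_side (broom D n M p) C"
    show "1 \<le> cut_weight (broom D n M p) C"
    proof (cases "cut_weight (broom D n M p) C < M")
      case True
      have "(p \<in> C) \<noteq> (Suc p \<in> C)"
        using cut_broom(2)[OF C True, of p] cut_broom(3)[OF C True, of "Suc p"] assms by auto
      then show ?thesis
        using weight_le_cut_weight[OF weighted_broom, of p "Suc p" p C] assms by (simp add: edges_broom weight_broom)
    qed (use M in linarith)
  qed
qed

text \<open>News of the light edge spreads one hop per round, and the vertices \<open>0\<close> and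
  \<open>2 * q\<close> are at least \<open>q - 1\<close> hops from both candidate places.\<close>

lemma broom_indistinguishable:
  assumes q: "q = D div 4" "Suc T < q" and p: "p \<in> {q, 3 * q, D}" "p' \<in> {q, 3 * q, D}"
    and local: "\<And>\<sigma> \<sigma>'. \<sigma> 0 = \<sigma>' 0 \<Longrightarrow> \<sigma> (2 * q) = \<sigma>' (2 * q) \<Longrightarrow> \<Phi> \<sigma> = \<Phi> \<sigma>'"
  shows "measure_pmf.prob (execution B A (broom D n M p) T) {\<sigma>. \<Phi> \<sigma>} =
    measure_pmf.prob (execution B A (broom D n M p') T) {\<sigma>. \<Phi> \<sigma>}"
proof -
  define pos where "pos v = (if v \<le> D then v else D div 2)" for v
  define far where "far t = {v. v < n \<and> (pos v + t + 1 < q \<or> pos v > q + t + 1) \<and>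
      (pos v + t + 1 < 3 * q \<or> pos v > 3 * q + t + 1)}" for t
  \<comment> \<open>The position of the light edge plays \<open>y\<close>. Neighbours of
    \<open>far (Suc t)\<close> lie in \<open>far t\<close>, so no message has to be
    exchanged.\<close>
  interpret two_party "{()}" "{q, 3 * q, D}" "\<lambda>_. broom D n M" "{..<n}" far "\<lambda>_. {}" "\<lambda>_. {}" 0 T
  proof
    show "start (broom D n M y) v = start (broom D n M y') v"
      if "y \<in> {q, 3 * q, D}" "y' \<in> {q, 3 * q, D}" "v \<in> far 0" for y y' v
    proof -
      have "(if {u, v} = {z, Suc z} then 1 else M) = M"
        if "{u, v} \<in> edges (broom D n M 0)" "z \<in> {q, 3 * q, D}" for u z
      proof -
        have "{u, v} \<noteq> {z, Suc z}"
        proof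
          assume eq: "{u, v} = {z, Suc z}"
          then consider "u = z" "v = Suc z" | "v = z" "u = Suc z" by (auto simp: doubleton_eq_iff)
          then have "z \<noteq> D \<and> (v = z \<or> v = Suc z)"
            using that(1) D4 by cases (auto simp: edges_broom)
          moreover from this have "pos v = v"
            using that(2) q(1) by (auto simp: pos_def)
          ultimately show False
            using that(2) \<open>v \<in> far 0\<close> by (auto simp: far_def)
        qed
        then show ?thesis by simp
      qed
      then have "(if {u, v} \<in> edges (broom D n M y) then Some (weight (broom D n M y) {u, v}) else None) =
          (if {u, v} \<in> edges (broom D n M y') then Some (weight (broom D n M y') {u, v}) else None)" for u
        using that by (simp add: weight_broom edges_broom)
      then show ?thesis unfolding start_def by presburger
    qed
    show "u \<in> far t \<or> (u, v) \<in> {}" if "v \<in> far (Suc t)" "{u, v} \<in> edges (broom D n M y)" for t u v y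
    proof -
      have "pos u \<le> Suc (pos v)" "pos v \<le> Suc (pos u)" "u < n"
        using that(2) Dn by (auto simp: pos_def edges_broom)
      then show ?thesis using that(1) by (auto simp: far_def)
    qed
  qed (auto simp: far_def)
  show ?thesis
  proof (rule prob_eq_if_no_crossing[of "()"])
    fix \<sigma> \<sigma>' :: "nat \<Rightarrow> history" assume *: "\<And>v. v \<in> far T \<Longrightarrow> \<sigma> v = \<sigma>' v"
    have "0 \<in> far T" "2 * q \<in> far T"
      using q Dn by (auto simp: far_def pos_def)
    then show "\<Phi> \<sigma> = \<Phi> \<sigma>'" by (intro local *)
  qed (use p in auto)
qed

end

text \<open>For the approximation, a light edge (connectivity 1) is compared with none (at least
  \<open>M > \<alpha>\<close>). For the cut, the connectivity is 1 in both graphs, but a light edge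
  at \<open>q\<close> separates \<open>0\<close> from \<open>2 * q\<close> and one at
  \<open>3 * q\<close> does not.\<close>

lemma diameter_lower_bound:
  assumes eps: "\<epsilon> < 1 / 2" and W: "W = UNIV \<or> W = \<nat>" and D: "16 \<le> D" "D < n" and \<alpha>: "1 \<le> \<alpha>"
  shows "approximates_connectivity B \<alpha> \<epsilon> (inputs W n D) T A \<Longrightarrow> D div 4 \<le> Suc T"
    and "computes_min_cut_knowing_connectivity B \<alpha> \<epsilon> (inputs W n D) T A' \<Longrightarrow> D div 4 \<le> Suc T"
proof -
  define q where "q = D div 4"
  \<comment> \<open>An integer above \<open>\<alpha>\<close>, so that it is a legal weight for
    \<open>\<nat>\<close> as well as for \<open>UNIV\<close>.\<close>
  define M where "M = real (nat \<lceil>\<alpha>\<rceil> + 1)"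
  have "M \<in> \<nat>" unfolding M_def by (rule of_nat_in_Nats)
  then have M': "M > \<alpha>" "M \<in> W" "1 \<in> W" "1 < M"
    using W \<alpha> unfolding M_def by (auto, linarith+)
  interpret broom_graph D n M
    using D M' by unfold_locales auto
  note inp = broom_inputs[OF M'(2,3)]
  have q: "q < D" "3 * q < D" "2 * q > q" "2 * q < 3 * q" using D by (auto simp: q_def)
  show "D div 4 \<le> Suc T" if A: "approximates_connectivity B \<alpha> \<epsilon> (inputs W n D) T A"
  proof (rule ccontr)
    assume "\<not> D div 4 \<le> Suc T"
    then have qT: "Suc T < q" by (simp add: q_def)
    let ?\<Phi> = "\<lambda>\<sigma>. answer A (\<sigma> 0) \<le> \<alpha>"
    have "measure_pmf.prob (execution B A (broom D n M q) T) {\<sigma>. ?\<Phi> \<sigma>} \<ge> 1 - \<epsilon>"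
      by (rule prob_ge_if_implied[OF approximates_connectivityD[OF A inp[of q]]])
        (use D in \<open>auto simp: edge_connectivity_broom_light[OF q(1)]\<close>)
    moreover have "measure_pmf.prob (execution B A (broom D n M D) T) {\<sigma>. ?\<Phi> \<sigma>} \<le> \<epsilon>"
    proof (rule prob_le_if_disjoint[OF approximates_connectivityD[OF A inp[of D]]])
      fix \<sigma> :: "nat \<Rightarrow> history"
      assume "\<sigma> \<in> {\<sigma>. \<forall>v\<in>verts (broom D n M D). answer A (\<sigma> v) \<in>
        {edge_connectivity (broom D n M D)..\<alpha> * edge_connectivity (broom D n M D)}}"
      then have "answer A (\<sigma> 0) \<ge> edge_connectivity (broom D n M D)"
        using D by auto
      then show "\<not> ?\<Phi> \<sigma>"
        using M'(1) edge_connectivity_broom_heavy[of D] by simp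
    qed
    moreover have "measure_pmf.prob (execution B A (broom D n M q) T) {\<sigma>. ?\<Phi> \<sigma>} =
        measure_pmf.prob (execution B A (broom D n M D) T) {\<sigma>. ?\<Phi> \<sigma>}"
      by (rule broom_indistinguishable[OF q_def qT]) auto
    ultimately show False using eps by linarith
  qed
  show "D div 4 \<le> Suc T" if A: "computes_min_cut_knowing_connectivity B \<alpha> \<epsilon> (inputs W n D) T A'"
  proof (rule ccontr)
    assume "\<not> D div 4 \<le> Suc T"
    then have qT: "Suc T < q" by (simp add: q_def)
    let ?A = "A' 1"
    let ?\<Phi> = "\<lambda>\<sigma>. answer ?A (\<sigma> 0) = answer ?A (\<sigma> (2 * q))"
    have prob: "measure_pmf.prob (execution B ?A (broom D n M p) T)
        {\<sigma>. approx_min_cut \<alpha> (broom D n M p) {v \<in> {..<n}. answer ?A (\<sigma> v)}} \<ge> 1 - \<epsilon>" if "p < D" for p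
      using computes_min_cutD[OF A inp[of p] edge_connectivity_broom_light[OF that]] by simp
    have cut: "proper_side (broom D n M p) C" "cut_weight (broom D n M p) C < M"
      if "approx_min_cut \<alpha> (broom D n M p) C" "p < D" for p C
      using that(1) M' unfolding approx_min_cut_def edge_connectivity_broom_light[OF that(2)] by auto
    have "measure_pmf.prob (execution B ?A (broom D n M (3 * q)) T) {\<sigma>. ?\<Phi> \<sigma>} \<ge> 1 - \<epsilon>"
    proof (rule prob_ge_if_implied[OF prob[OF q(2)]], drule CollectD)
      fix \<sigma> :: "nat \<Rightarrow> history"
      assume C: "approx_min_cut \<alpha> (broom D n M (3 * q)) {v \<in> {..<n}. answer ?A (\<sigma> v)}"
      show "?\<Phi> \<sigma>"
        using cut_broom(2)[OF cut[OF C q(2)], of "2 * q"] q D by simp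
    qed
    moreover have "measure_pmf.prob (execution B ?A (broom D n M q) T) {\<sigma>. ?\<Phi> \<sigma>} \<le> \<epsilon>"
    proof (rule prob_le_if_disjoint[OF prob[OF q(1)]], drule CollectD)
      fix \<sigma> :: "nat \<Rightarrow> history"
      assume C: "approx_min_cut \<alpha> (broom D n M q) {v \<in> {..<n}. answer ?A (\<sigma> v)}"
      show "\<not> ?\<Phi> \<sigma>"
        using cut_broom(3)[OF cut[OF C q(1)], of "2 * q"] q D by simp
    qed
    moreover have "measure_pmf.prob (execution B ?A (broom D n M (3 * q)) T) {\<sigma>. ?\<Phi> \<sigma>} =
        measure_pmf.prob (execution B ?A (broom D n M q) T) {\<sigma>. ?\<Phi> \<sigma>}"
      by (rule broom_indistinguishable[OF q_def qT]) auto
    ultimately show False using eps by linarith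
  qed
qed

section \<open>The strand graph\<close>

definition layer :: "nat set \<Rightarrow> nat set \<Rightarrow> nat \<Rightarrow> nat \<Rightarrow> nat" where
  "layer x y k = (if even k then if k div 4 \<in> x then Transposition.transpose 0 1 else id
                  else if k div 4 \<in> y then Transposition.transpose 1 2 else id)"

primrec token :: "nat set \<Rightarrow> nat set \<Rightarrow> nat \<Rightarrow> nat" where
  "token x y 0 = 2"
| "token x y (Suc k) = layer x y k (token x y k)"

lemma layer_less_3: "p < 3 \<Longrightarrow> layer x y k p < 3"
  by (auto simp: layer_def Transposition.transpose_def)

lemma inj_layer: "layer x y k p = layer x y k p' \<longleftrightarrow> p = p'"
  by (auto simp: layer_def transpose_eq_iff)

lemma surj_layer_less_3: "p < 3 \<Longrightarrow> \<exists>p'<3. layer x y k p' = p"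
  by (intro exI[of _ "layer x y k p"]) (auto simp: layer_def layer_less_3 Transposition.transpose_def)

lemma token_less_3: "token x y k < 3"
  by (induction k) (auto intro: layer_less_3)

text \<open>The four layers of block \<open>j\<close> form the commutator of two transpositions of \<open>S\<^sub>3\<close>,
  a 3-cycle, if \<open>j \<in> x \<inter> y\<close>, and cancel otherwise.\<close>

lemma token_block:
  "token x y (4 * j + 4) = (if j \<in> x \<inter> y then (token x y (4 * j) + 1) mod 3 else token x y (4 * j))"
proof -
  have "token x y (4 * j + 4) =
      layer x y (4 * j + 3) (layer x y (4 * j + 2) (layer x y (4 * j + 1) (layer x y (4 * j) (token x y (4 * j)))))"
    by (simp add: eval_nat_numeral)
  moreover have "(4 * j + 3) div 4 = j" "(4 * j + 2) div 4 = j" "(4 * j + 1) div 4 = j" by auto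
  moreover have "token x y (4 * j) \<in> {0, 1, 2}" using token_less_3[of x y "4 * j"] by auto
  ultimately show ?thesis
    by (auto simp: layer_def Transposition.transpose_def)
qed

lemma token_eq: "token x y (4 * j) = (2 + card (x \<inter> y \<inter> {..<j})) mod 3"
proof (induction j)
  case (Suc j)
  have "x \<inter> y \<inter> {..<Suc j} = (if j \<in> x \<inter> y then insert j (x \<inter> y \<inter> {..<j}) else x \<inter> y \<inter> {..<j})"
    by (auto simp: less_Suc_eq)
  then have c: "card (x \<inter> y \<inter> {..<Suc j}) = (if j \<in> x \<inter> y then 1 else 0) + card (x \<inter> y \<inter> {..<j})"
    by simp
  have t: "4 * Suc j = 4 * j + 4" by simp
  show ?case
    unfolding t token_block Suc c by (cases "j \<in> x \<inter> y") (simp_all only: if_True if_False simp_thms, presburger+)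
qed simp

lemma token_eq_2_iff:
  assumes "x \<subseteq> {..<m}"
  shows "token x y (4 * m) = 2 \<longleftrightarrow> card (x \<inter> y) mod 3 = 0"
proof -
  have "x \<inter> y \<inter> {..<m} = x \<inter> y" using assms by auto
  then show ?thesis unfolding token_eq by presburger
qed

text \<open>A path \<open>0, \<dots>, D\<close> fixes the diameter. At its centre hang spare leaves and a grid of
  \<open>12 m + 4\<close> rows and \<open>l\<close> columns. Row \<open>0\<close> is the spine; the row \<open>strand k p\<close> is position \<open>p\<close> of
  layer \<open>k\<close>, and consecutive layers are joined by \<open>layer x y k\<close>, at the left end for even \<open>k\<close>
  (depending on \<open>x\<close>) and at the right end for odd \<open>k\<close> (depending on \<open>y\<close>). Positions \<open>0\<close> and \<open>1\<close> of the
  first layer are tied to the spine, so the rows through which \<open>token\<close> passes are the only part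
  that heavy edges may leave disconnected; if \<open>fin\<close> holds, they are tied to the spine exactly
  if the token ends in position \<open>2\<close>.\<close>

locale strand_graph =
  fixes D n m l \<kappa> :: nat and M :: real and fin :: bool
  assumes l2: "2 \<le> l" and l\<kappa>: "l \<le> 2 ^ \<kappa>" and \<kappa>D: "\<kappa> + 2 \<le> D div 2"
    and fits: "D + 1 + (12 * m + 4) * l \<le> n" and M1: "1 < M"
begin

definition rows :: nat where "rows = 12 * m + 4"
definition base :: nat where "base = D + 1 + rows * l"
definition cell :: "nat \<Rightarrow> nat \<Rightarrow> nat" where "cell r i = D + 1 + r * l + i"
definition strand :: "nat \<Rightarrow> nat \<Rightarrow> nat" where "strand k p = 1 + 3 * k + p"
text \<open>Vertices off the grid get the column of the cell that attaches them, so a heavy edge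
  changes the column by at most one.\<close>

definition col :: "nat \<Rightarrow> nat" where "col v = (if D < v \<and> v < base then (v - D - 1) mod l else 0)"

inductive heavy :: "nat set \<Rightarrow> nat set \<Rightarrow> nat \<Rightarrow> nat \<Rightarrow> bool" for x y where
  path: "i < D \<Longrightarrow> heavy x y i (Suc i)"
| leaf: "base \<le> j \<Longrightarrow> j < n \<Longrightarrow> heavy x y (D div 2) j"
| root: "heavy x y (D div 2) (cell 0 0)"
| row: "r < rows \<Longrightarrow> Suc i < l \<Longrightarrow> heavy x y (cell r i) (cell r (Suc i))"
| left_end: "k < 4 * m \<Longrightarrow> even k \<Longrightarrow> p < 3 \<Longrightarrow>
    heavy x y (cell (strand k p) 0) (cell (strand (Suc k) (layer x y k p)) 0)"
| right_end: "k < 4 * m \<Longrightarrow> odd k \<Longrightarrow> p < 3 \<Longrightarrow>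
    heavy x y (cell (strand k p) (l - 1)) (cell (strand (Suc k) (layer x y k p)) (l - 1))"
| first: "p < 2 \<Longrightarrow> heavy x y (cell 0 0) (cell (strand 0 p) 0)"
| final: "fin \<Longrightarrow> heavy x y (cell 0 0) (cell (strand (4 * m) 2) 0)"

text \<open>Level 0 of this dyadic hierarchy is the heavy spine itself, hence
  \<open>1 \<le> k\<close>; a shortcut then spans at least two columns and is never heavy.\<close>

inductive shortcut :: "nat \<Rightarrow> nat \<Rightarrow> bool" where
  "1 \<le> k \<Longrightarrow> 2 ^ k * Suc j < l \<Longrightarrow> shortcut (cell 0 (2 ^ k * j)) (cell 0 (2 ^ k * Suc j))"

text \<open>Rungs keep the diameter small without carrying information between columns; those at the
  token's rows make up the light cut.\<close>

inductive rung :: "nat \<Rightarrow> nat \<Rightarrow> bool" where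
  "0 < r \<Longrightarrow> r < rows \<Longrightarrow> i < l \<Longrightarrow> rung (cell 0 i) (cell r i)"

definition graph :: "nat set \<Rightarrow> nat set \<Rightarrow> wgraph" where
  "graph x y =
     \<lparr>verts = {..<n},
      edges = {{u, v} | u v. heavy x y u v \<or> shortcut u v \<or> rung u v},
      weight = (\<lambda>e. if \<exists>u v. heavy x y u v \<and> e = {u, v} then M else 1)\<rparr>"

section \<open>Grid coordinates and hop distances from the centre\<close>

lemma base_le: "base \<le> n"
  using fits by (simp add: base_def rows_def)

lemma D_less: "D < n"
  using fits by simp

lemma l_pos: "0 < l" using l2 by simp

lemma strand_less_rows: "k \<le> 4 * m \<Longrightarrow> p < 3 \<Longrightarrow> strand k p < rows"
  by (simp add: strand_def rows_def)

lemma strand_pos [simp]: "0 < strand k p" "strand k p \<noteq> 0"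
  by (simp_all add: strand_def)

lemma strand_inj: "p < 3 \<Longrightarrow> p' < 3 \<Longrightarrow> strand k p = strand k' p' \<longleftrightarrow> k = k' \<and> p = p'"
  unfolding strand_def by presburger

lemma row_cases:
  assumes "r < rows"
  obtains "r = 0" | k p where "k \<le> 4 * m" "p < 3" "r = strand k p"
proof (cases "r = 0")
  case False
  have "r = strand ((r - 1) div 3) ((r - 1) mod 3)"
    using False by (simp add: strand_def)
  moreover have "(r - 1) div 3 \<le> 4 * m" using assms by (simp add: rows_def)
  ultimately show ?thesis using that(2)[of "(r - 1) div 3" "(r - 1) mod 3"] by simp
qed (use that in simp)

lemma cell_gt: "D < cell r i"
  by (simp add: cell_def)

lemma cell_less_base: "r < rows \<Longrightarrow> i < l \<Longrightarrow> cell r i < base"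
proof -
  assume "r < rows" "i < l"
  then have "r * l + i < Suc r * l" by simp
  also have "Suc r * l \<le> rows * l"
    by (rule mult_le_mono1) (use \<open>r < rows\<close> in simp)
  finally show ?thesis by (simp add: cell_def base_def)
qed

lemma cell_less: "r < rows \<Longrightarrow> i < l \<Longrightarrow> cell r i < n"
  using cell_less_base base_le by (meson less_le_trans)

lemma cell_inj: "i < l \<Longrightarrow> i' < l \<Longrightarrow> cell r i = cell r' i' \<longleftrightarrow> r = r' \<and> i = i'"
proof
  assume *: "i < l" "i' < l" "cell r i = cell r' i'"
  then have eq: "r * l + i = r' * l + i'" by (simp add: cell_def)
  have "r = (r * l + i) div l" "r' = (r' * l + i') div l" "i = (r * l + i) mod l" "i' = (r' * l + i') mod l"
    using * by auto
  then show "r = r' \<and> i = i'" using eq by metis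
qed simp

lemma col_cell [simp]: "r < rows \<Longrightarrow> i < l \<Longrightarrow> col (cell r i) = i"
  using cell_less_base[of r i] cell_gt[of r i] by (simp add: col_def) (simp add: cell_def)

lemma col_path: "v \<le> D \<Longrightarrow> col v = 0" and col_leaf: "base \<le> v \<Longrightarrow> col v = 0"
  by (auto simp: col_def)

lemma rows_pos: "0 < rows" by (simp add: rows_def)

lemma vertex_cases:
  assumes "v < n"
  obtains "v \<le> D" | "base \<le> v" | r i where "r < rows" "i < l" "v = cell r i"
proof (cases "v \<le> D \<or> base \<le> v")
  case False
  have "v - D - 1 < rows * l"
    using False by (auto simp: base_def)
  then have "(v - D - 1) div l < rows"
    by (rule less_mult_imp_div_less)
  moreover have "v = cell ((v - D - 1) div l) ((v - D - 1) mod l)"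
    using False by (simp add: cell_def)
  ultimately show ?thesis using that(3) l_pos by (metis mod_less_divisor)
qed (use that in auto)

lemmas heavy_strands = strand_less_rows layer_less_3

lemma heavy_col: "heavy x y u v \<Longrightarrow> col u \<le> Suc (col v) \<and> col v \<le> Suc (col u)"
  by (induction rule: heavy.induct)
    (use l2 rows_pos in \<open>auto simp: col_path col_leaf heavy_strands\<close>)

lemma heavy_less: "heavy x y u v \<Longrightarrow> u < n \<and> v < n \<and> u \<noteq> v"
proof (induction rule: heavy.induct)
  case (leaf j)
  then show ?case using D_less by (auto simp: base_def)
next
  case root
  then show ?case using D_less cell_gt[of 0 0] cell_less[of 0 0] rows_pos l_pos by auto
next
  case (left_end k p)
  then show ?case using l_pos strand_less_rows[of k p] strand_less_rows[of "Suc k" "layer x y k p"]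
    by (auto simp: cell_less cell_inj layer_less_3 strand_inj)
next
  case (right_end k p)
  then show ?case using l_pos strand_less_rows[of k p] strand_less_rows[of "Suc k" "layer x y k p"]
    by (auto simp: cell_less cell_inj layer_less_3 strand_inj)
qed (use D_less l_pos rows_pos in \<open>auto simp: cell_less cell_inj strand_less_rows strand_def rows_def\<close>)

lemma shortcut_less: "shortcut u v \<Longrightarrow> u < n \<and> v < n \<and> D < u \<and> D < v \<and> col u + 2 \<le> col v"
proof (induction rule: shortcut.induct)
  case (1 k j)
  have "(2::nat) ^ 1 \<le> 2 ^ k" using 1 by (intro power_increasing) auto
  moreover have "2 ^ k * j < l" using 1 by simp
  ultimately show ?case using 1 rows_pos by (auto simp: cell_less cell_gt simp del: mult_Suc_right) simp
qed

lemma rung_less: "rung u v \<Longrightarrow> u < n \<and> v < n \<and> D < u \<and> D < v \<and> u \<noteq> v \<and> col u = col v"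
  by (induction rule: rung.induct) (use rows_pos in \<open>auto simp: cell_less cell_gt cell_inj\<close>)

lemma verts_graph [simp]: "verts (graph x y) = {..<n}"
  by (simp add: graph_def)

lemma edges_graph: "{u, v} \<in> edges (graph x y) \<longleftrightarrow>
    heavy x y u v \<or> heavy x y v u \<or> shortcut u v \<or> shortcut v u \<or> rung u v \<or> rung v u"
  by (auto simp: graph_def doubleton_eq_iff)

lemma weight_graph: "weight (graph x y) {u, v} = (if heavy x y u v \<or> heavy x y v u then M else 1)"
  by (auto simp: graph_def doubleton_eq_iff)

lemma edge_graphE:
  assumes "e \<in> edges (graph x y)"
  obtains u v where "e = {u, v}" "heavy x y u v \<or> shortcut u v \<or> rung u v"
  using assms by (auto simp: graph_def)

lemma weighted_graph: "weighted_graph (graph x y)"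
  unfolding weighted_graph_def
proof (intro conjI ballI)
  fix e assume "e \<in> edges (graph x y)"
  then obtain u v where e: "e = {u, v}" and uv: "heavy x y u v \<or> shortcut u v \<or> rung u v"
    by (rule edge_graphE)
  have "u < n \<and> v < n \<and> u \<noteq> v"
    using uv heavy_less shortcut_less rung_less by fastforce
  then show "e \<subseteq> verts (graph x y)" "card e = 2" by (auto simp: e)
  show "1 \<le> weight (graph x y) e" using M1 by (simp add: e weight_graph)
qed simp

text \<open>The target is column \<open>i\<close> with its last \<open>s\<close> binary digits
  cleared. All digits are cleared at column 0, and restoring one costs at most one hop.\<close>

lemma spine_near:
  assumes "i < l" "s \<le> \<kappa>"
  shows "\<exists>k\<le>\<kappa> - s. (cell 0 0, cell 0 (2 ^ s * (i div 2 ^ s))) \<in> adjacency (graph x y) ^^ k"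
  using assms(2)
proof (induction s rule: inc_induct)
  case base
  have "i div 2 ^ \<kappa> = 0" using assms l\<kappa> by simp
  then show ?case by auto
next
  case (step s)
  define j where "j = i div 2 ^ Suc s"
  obtain k where k: "k \<le> \<kappa> - Suc s" "(cell 0 0, cell 0 (2 ^ Suc s * j)) \<in> adjacency (graph x y) ^^ k"
    using step.IH by (auto simp: j_def)
  have "i div 2 ^ Suc s = i div 2 ^ s div 2"
    by (simp only: power_Suc2 div_mult2_eq)
  then have "i div 2 ^ s = 2 * j \<or> i div 2 ^ s = Suc (2 * j)"
    unfolding j_def by linarith
  then show ?case
  proof
    assume "i div 2 ^ s = 2 * j"
    then show ?thesis using k by (intro exI[of _ k]) (auto simp: mult_ac)
  next
    assume odd: "i div 2 ^ s = Suc (2 * j)"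
    have "2 ^ s * (i div 2 ^ s) \<le> i" by simp
    then have lt: "2 ^ s * Suc (2 * j) < l" using assms(1) odd by simp
    have "heavy x y (cell 0 (2 ^ s * (2 * j))) (cell 0 (2 ^ s * Suc (2 * j))) \<or>
        shortcut (cell 0 (2 ^ s * (2 * j))) (cell 0 (2 ^ s * Suc (2 * j)))"
    proof (cases "s = 0")
      case True
      then show ?thesis using heavy.row[of 0 "2 * j" x y] lt rows_pos by simp
    next
      case False
      then show ?thesis using shortcut.intros[of s "2 * j"] lt by simp
    qed
    then have "(cell 0 (2 ^ Suc s * j), cell 0 (2 ^ s * (i div 2 ^ s))) \<in> adjacency (graph x y)"
      unfolding odd adjacency_iff edges_graph power_Suc2 mult.assoc by blast
    then have "(cell 0 0, cell 0 (2 ^ s * (i div 2 ^ s))) \<in> adjacency (graph x y) ^^ Suc k"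
      by (rule relpow_Suc_I[OF k(2)])
    moreover have "Suc k \<le> \<kappa> - s" using k(1) step.hyps by simp
    ultimately show ?thesis by blast
  qed
qed

lemma centre_near:
  assumes "D < v" "v < n"
  shows "\<exists>k\<le>D div 2. (D div 2, v) \<in> adjacency (graph x y) ^^ k"
  using assms(2)
proof (cases rule: vertex_cases)
  case 1
  then show ?thesis using assms by simp
next
  case 2
  then show ?thesis using heavy.leaf[OF 2 assms(2)] \<kappa>D
    by (intro exI[of _ 1]) (auto simp: adjacency_iff edges_graph)
next
  case (3 r i)
  obtain k where k: "k \<le> \<kappa>" "(cell 0 0, cell 0 i) \<in> adjacency (graph x y) ^^ k"
    using spine_near[OF \<open>i < l\<close>, of 0] by auto
  have "(D div 2, cell 0 0) \<in> adjacency (graph x y)"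
    by (simp add: adjacency_iff edges_graph heavy.root)
  then have *: "(D div 2, cell 0 i) \<in> adjacency (graph x y) ^^ Suc k"
    by (rule relpow_Suc_I2[OF _ k(2)])
  show ?thesis
  proof (cases "r = 0")
    case True
    then show ?thesis using * 3 k(1) \<kappa>D by (intro exI[of _ "Suc k"]) auto
  next
    case False
    then have "(cell 0 i, v) \<in> adjacency (graph x y)"
      using 3 rung.intros[of r i] by (simp add: adjacency_iff edges_graph)
    then have "(D div 2, v) \<in> adjacency (graph x y) ^^ Suc (Suc k)"
      by (rule relpow_Suc_I[OF *])
    then show ?thesis using k(1) \<kappa>D by (intro exI[of _ "Suc (Suc k)"]) auto
  qed
qed

lemma heavy_path_side:
  "heavy x y u v \<Longrightarrow> (u \<le> D \<longrightarrow> v \<le> D \<longrightarrow> v = Suc u) \<and> (u \<le> D \<longrightarrow> D < v \<longrightarrow> u = D div 2) \<and> (v \<le> D \<longrightarrow> u \<le> D)"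
  by (induction rule: heavy.induct) (auto simp: cell_def base_def)

lemma graph_inputs:
  assumes "M \<in> W" "1 \<in> W"
  shows "graph x y \<in> inputs W n D"
proof -
  have path: "{i, Suc i} \<in> edges (graph x y)" if "i < D" for i
    using that by (simp add: edges_graph heavy.path)
  have inner: "v = Suc u \<or> u = Suc v" if "{u, v} \<in> edges (graph x y)" "u \<le> D" "v \<le> D" for u v
    using that heavy_path_side[of x y u v] heavy_path_side[of x y v u]
    by (auto simp: edges_graph dest: shortcut_less rung_less)
  have outer: "u = D div 2" if "{u, v} \<in> edges (graph x y)" "u \<le> D" "D < v" for u v
    using that heavy_path_side[of x y u v] heavy_path_side[of x y v u]
    by (auto simp: edges_graph dest: shortcut_less rung_less)
  have "connected_graph (graph x y)" "hop_diameter (graph x y) = D"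
    by (rule hop_diameter_path_with_centre[OF verts_graph D_less path centre_near inner outer]; assumption)+
  moreover have "weight (graph x y) ` edges (graph x y) \<subseteq> W"
    using assms by (auto simp: graph_def)
  ultimately show ?thesis
    unfolding inputs_def by (simp add: weighted_graph)
qed

end

section \<open>Cuts of the strand graph\<close>

context strand_graph
begin

definition token_side :: "nat set \<Rightarrow> nat set \<Rightarrow> nat set" where
  "token_side x y = {cell (strand k (token x y k)) i | k i. k \<le> 4 * m \<and> i < l}"

definition token_rungs :: "nat set \<Rightarrow> nat set \<Rightarrow> nat set set" where
  "token_rungs x y = (\<lambda>(k, i). {cell 0 i, cell (strand k (token x y k)) i}) ` ({..4 * m} \<times> {..<l})"

lemma cell_in_token_side:
  assumes "k \<le> 4 * m" "p < 3" "i < l"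
  shows "cell (strand k p) i \<in> token_side x y \<longleftrightarrow> p = token x y k"
proof
  assume "cell (strand k p) i \<in> token_side x y"
  then obtain k' i' where "i' < l" "cell (strand k p) i = cell (strand k' (token x y k')) i'"
    unfolding token_side_def by auto
  then have "strand k p = strand k' (token x y k')"
    using assms by (simp add: cell_inj)
  then show "p = token x y k"
    using assms strand_inj[of p "token x y k'" k k'] token_less_3[of x y k'] by simp
qed (use assms in \<open>auto simp: token_side_def\<close>)

lemma not_in_token_side:
  "i < l \<Longrightarrow> cell 0 i \<notin> token_side x y" "v \<le> D \<Longrightarrow> v \<notin> token_side x y"
  "base \<le> v \<Longrightarrow> v \<notin> token_side x y"
proof -
  show "cell 0 i \<notin> token_side x y" if "i < l"
    using that by (auto simp: token_side_def cell_inj strand_def)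
  show "v \<notin> token_side x y" if "v \<le> D"
    using that cell_gt by (auto simp: token_side_def not_le[symmetric])
  show "v \<notin> token_side x y" if "base \<le> v"
    using that cell_less_base strand_less_rows token_less_3 by (fastforce simp: token_side_def not_le[symmetric])
qed

text \<open>The count depends on neither \<open>x\<close> nor \<open>y\<close>, so knowing the
  connectivity of the light case does not reveal the answer.\<close>

lemma card_token_rungs: "card (token_rungs x y) = (4 * m + 1) * l"
proof -
  have "inj_on (\<lambda>(k, i). {cell 0 i, cell (strand k (token x y k)) i}) ({..4 * m} \<times> {..<l})"
    by (intro inj_onI) (auto simp: doubleton_eq_iff cell_inj strand_inj token_less_3)
  then show ?thesis
    unfolding token_rungs_def by (subst card_image) (auto simp: card_cartesian_product)
qed

lemma token_rungs_edges: "token_rungs x y \<subseteq> edges (graph x y)"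
  using strand_less_rows token_less_3
  by (auto simp: token_rungs_def edges_graph intro!: rung.intros)

text \<open>The token follows the layers that wire the rows, and layers are injective, so heavy
  edges never join a token row to another row. The one exception, a \<open>final\<close> edge at a
  token in position 2, is excluded.\<close>

lemma heavy_token_side:
  assumes "heavy x y u v" "\<not> (fin \<and> token x y (4 * m) = 2)"
  shows "u \<in> token_side x y \<longleftrightarrow> v \<in> token_side x y"
  using assms(1)
proof cases
  case (row r i)
  show ?thesis
    using \<open>r < rows\<close>
    by (cases r rule: row_cases) (use row in \<open>auto simp: not_in_token_side cell_in_token_side\<close>)
next
  case (left_end k p)
  then show ?thesis using l_pos by (simp add: cell_in_token_side layer_less_3 inj_layer)
next
  case (right_end k p)
  then show ?thesis using l_pos by (simp add: cell_in_token_side layer_less_3 inj_layer)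
next
  case (first p)
  then show ?thesis using l_pos by (simp add: cell_in_token_side not_in_token_side)
next
  case final
  then show ?thesis using l_pos assms(2) by (simp add: cell_in_token_side not_in_token_side)
qed (use l_pos in \<open>auto simp: not_in_token_side\<close>)

lemma cut_weight_token_side:
  assumes "\<not> (fin \<and> token x y (4 * m) = 2)"
  shows "cut_weight (graph x y) (token_side x y) \<le> real ((4 * m + 1) * l)"
proof -
  let ?S = "{e \<in> edges (graph x y). card (e \<inter> token_side x y) = 1}"
  have S: "e \<in> token_rungs x y \<and> weight (graph x y) e = 1" if "e \<in> ?S" for e
  proof -
    from that have "e \<in> edges (graph x y)" by simp
    then obtain u v where e: "e = {u, v}" and uv: "heavy x y u v \<or> shortcut u v \<or> rung u v"
      by (rule edge_graphE)
    have "(u \<in> token_side x y) \<noteq> (v \<in> token_side x y)"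
      using that card_doubleton_Int_eq_1[of u v] weighted_graph_edgeD[OF weighted_graph] by (auto simp: e)
    then have cross: "(u \<in> token_side x y) \<noteq> (v \<in> token_side x y)" "\<not> heavy x y u v" "\<not> heavy x y v u"
      using heavy_token_side[OF _ assms, of u v] heavy_token_side[OF _ assms, of v u] by auto
    have "\<not> shortcut u v"
    proof
      assume "shortcut u v"
      then show False
        using cross(1)
      proof cases
        case (1 k j)
        moreover have "2 ^ k * j < l" using 1 by simp
        ultimately show False using cross(1) by (simp add: not_in_token_side del: mult_Suc_right)
      qed
    qed
    with uv cross have "rung u v" by blast
    then have "e \<in> token_rungs x y"
    proof cases
      case (1 r i)
      then obtain k p where kp: "k \<le> 4 * m" "p < 3" "r = strand k p"
        using row_cases[of r] by auto
      then have "p = token x y k"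
        using cross(1) 1 by (auto simp: not_in_token_side cell_in_token_side)
      then show ?thesis
        using 1 kp e by (auto simp: token_rungs_def intro!: image_eqI[of _ _ "(k, i)"])
    qed
    then show ?thesis using cross by (simp add: e weight_graph)
  qed
  have "cut_weight (graph x y) (token_side x y) = real (card ?S)"
    unfolding cut_weight_def using S by simp
  also have "\<dots> \<le> real (card (token_rungs x y))"
    using S by (intro of_nat_mono card_mono) (auto simp: token_rungs_def)
  finally show ?thesis by (simp only: card_token_rungs)
qed

lemma proper_token_side: "proper_side (graph x y) (token_side x y)"
proof -
  have "cell (strand 0 2) 0 \<in> token_side x y"
    using l_pos by (simp add: cell_in_token_side)
  moreover have "0 \<in> {..<n}" "0 \<notin> token_side x y"
    using D_less by (auto simp: not_in_token_side)
  moreover have "token_side x y \<subseteq> {..<n}"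
    by (auto simp: token_side_def cell_less strand_less_rows token_less_3)
  ultimately show ?thesis
    unfolding proper_side_def verts_graph by blast
qed

text \<open>No heavy edge crosses a cut below \<open>M\<close>. This leaves two candidate classes,
  the token rows and all the rest, which a proper cut must separate; a \<open>final\<close> edge
  would merge them if the token ended in position 2.\<close>

lemma light_cut:
  assumes C: "proper_side (graph x y) C" and light: "cut_weight (graph x y) C < M"
  shows "\<not> (fin \<and> token x y (4 * m) = 2)"
    and "i < l \<Longrightarrow> cell 0 i \<in> C \<longleftrightarrow> 0 \<in> C"
    and "k \<le> 4 * m \<Longrightarrow> p < 3 \<Longrightarrow> i < l \<Longrightarrow> cell (strand k p) i \<in> C \<longleftrightarrow> ((0 \<in> C) \<noteq> (p = token x y k))"
proof -
  have heavy: "u \<in> C \<longleftrightarrow> v \<in> C" if "heavy x y u v" for u v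
    using weight_le_cut_weight[OF weighted_graph, of u v x y C] that light
    by (auto simp: weight_graph edges_graph)
  have path: "i \<in> C \<longleftrightarrow> 0 \<in> C" if "i \<le> D" for i
    using that by (induction i) (use heavy[OF heavy.path] in auto)
  have centre: "D div 2 \<in> C \<longleftrightarrow> 0 \<in> C" by (rule path) simp
  have leaf: "j \<in> C \<longleftrightarrow> 0 \<in> C" if "base \<le> j" "j < n" for j
    using heavy[OF heavy.leaf[OF that]] centre by simp
  have row: "cell r i \<in> C \<longleftrightarrow> cell r 0 \<in> C" if "r < rows" "i < l" for r i
    using that(2) by (induction i) (use heavy[OF heavy.row[OF that(1)]] in auto)
  have spine0: "cell 0 0 \<in> C \<longleftrightarrow> 0 \<in> C"
    using heavy[OF heavy.root] centre by simp
  have spine: "cell 0 i \<in> C \<longleftrightarrow> 0 \<in> C" if "i < l" for i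
    using row[OF rows_pos that] spine0 by simp
  let ?b = "\<lambda>k p. cell (strand k p) 0 \<in> C"
  have step: "?b (Suc k) (layer x y k p) \<longleftrightarrow> ?b k p" if "k < 4 * m" "p < 3" for k p
  proof (cases "even k")
    case True
    show ?thesis using heavy[OF heavy.left_end[OF that(1) True that(2)]] by simp
  next
    case False
    have "l - 1 < l" using l_pos by simp
    then show ?thesis
      using heavy[OF heavy.right_end[OF that(1) False that(2)]] that
        row[of "strand k p" "l - 1"] row[of "strand (Suc k) (layer x y k p)" "l - 1"]
      by (simp add: strand_less_rows layer_less_3)
  qed
  have first: "?b 0 p \<longleftrightarrow> 0 \<in> C" if "p < 2" for p
    using heavy[OF heavy.first[OF that]] spine0 by simp
  \<comment> \<open>Surjectivity of the layer provides the row feeding row \<open>p\<close>, and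
    injectivity makes it a token row exactly if \<open>p\<close> is one.\<close>
  have b: "?b k p \<longleftrightarrow> (if p = token x y k then ?b 0 2 else 0 \<in> C)" if "k \<le> 4 * m" "p < 3" for k p
    using that
  proof (induction k arbitrary: p)
    case 0
    show ?case
    proof (cases "p = 2")
      case False
      then show ?thesis using first[of p] 0 by simp
    qed simp
  next
    case (Suc k)
    obtain p' where p': "p' < 3" "layer x y k p' = p"
      using surj_layer_less_3[OF Suc.prems(2)] by blast
    have "?b (Suc k) p \<longleftrightarrow> ?b k p'"
      using step[of k p'] p' Suc.prems by simp
    also have "\<dots> \<longleftrightarrow> (if p' = token x y k then ?b 0 2 else 0 \<in> C)"
      using Suc.IH[OF _ p'(1)] Suc.prems by simp
    also have "p' = token x y k \<longleftrightarrow> p = token x y (Suc k)"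
      using p'(2) inj_layer by auto
    finally show ?case .
  qed
  have sep: "?b 0 2 \<longleftrightarrow> 0 \<notin> C"
  proof (rule ccontr)
    assume "\<not> (?b 0 2 \<longleftrightarrow> 0 \<notin> C)"
    then have const: "?b k p \<longleftrightarrow> 0 \<in> C" if "k \<le> 4 * m" "p < 3" for k p
      using b[OF that] by (simp split: if_splits)
    have "v \<in> C \<longleftrightarrow> 0 \<in> C" if "v < n" for v
      using that
    proof (cases rule: vertex_cases)
      case 1
      then show ?thesis by (rule path)
    next
      case 2
      then show ?thesis using leaf that by simp
    next
      case (3 r i)
      show ?thesis
        using \<open>r < rows\<close>
      proof (cases r rule: row_cases)
        case 1
        then show ?thesis using spine 3 by simp
      next
        case (2 k p)
        then show ?thesis using const[of k p] row[of r i] 3 by simp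
      qed
    qed
    then have "C = {} \<or> {..<n} \<subseteq> C"
      using C unfolding proper_side_def verts_graph by blast
    then show False using C unfolding proper_side_def verts_graph by blast
  qed
  show "\<not> (fin \<and> token x y (4 * m) = 2)"
  proof
    assume *: "fin \<and> token x y (4 * m) = 2"
    then have "?b (4 * m) 2 \<longleftrightarrow> 0 \<in> C"
      using heavy[OF heavy.final] spine0 by simp
    then show False using b[of "4 * m" 2] * sep by simp
  qed
  show "cell 0 i \<in> C \<longleftrightarrow> 0 \<in> C" if "i < l"
    by (rule spine[OF that])
  show "cell (strand k p) i \<in> C \<longleftrightarrow> ((0 \<in> C) \<noteq> (p = token x y k))" if "k \<le> 4 * m" "p < 3" "i < l"
    using b[OF that(1,2)] row[OF strand_less_rows[OF that(1,2)] that(3)] sep by simp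
qed

lemma edge_connectivity_heavy:
  assumes "fin" "token x y (4 * m) = 2"
  shows "M \<le> edge_connectivity (graph x y)"
  using light_cut(1)[of x y] assms
  by (intro edge_connectivity_ge[OF weighted_graph proper_token_side]) force

lemma edge_connectivity_light:
  assumes "\<not> (fin \<and> token x y (4 * m) = 2)" "real ((4 * m + 1) * l) \<le> M"
  shows "edge_connectivity (graph x y) = real ((4 * m + 1) * l)"
proof (rule antisym)
  show "edge_connectivity (graph x y) \<le> real ((4 * m + 1) * l)"
    using edge_connectivity_le[OF weighted_graph proper_token_side] cut_weight_token_side[OF assms(1)]
    by (rule order.trans)
  show "real ((4 * m + 1) * l) \<le> edge_connectivity (graph x y)"
  proof (rule edge_connectivity_ge[OF weighted_graph proper_token_side])
    fix C assume C: "proper_side (graph x y) C"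
    show "real ((4 * m + 1) * l) \<le> cut_weight (graph x y) C"
    \<comment> \<open>A cut below \<open>M\<close> separates token rows from the spine and hence
      contains all token rungs; any other cut already weighs at least \<open>M\<close>.\<close>
    proof (cases "cut_weight (graph x y) C < M")
      case True
      note lc = light_cut[OF C True]
      have cross: "card (e \<inter> C) = 1" if "e \<in> token_rungs x y" for e
      proof -
        from that obtain k i where e: "e = {cell 0 i, cell (strand k (token x y k)) i}" "k \<le> 4 * m" "i < l"
          by (auto simp: token_rungs_def)
        have "cell 0 i \<noteq> cell (strand k (token x y k)) i"
          using e by (simp add: cell_inj strand_def)
        then show ?thesis
          unfolding e(1) using lc(2)[OF e(3)] lc(3)[OF e(2) token_less_3 e(3)]
          by (subst card_doubleton_Int_eq_1) auto
      qed
      have "real ((4 * m + 1) * l) = (\<Sum>e\<in>token_rungs x y. 1)"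
        by (simp only: sum_constant card_token_rungs mult_1_right)
      also have "\<dots> \<le> sum (weight (graph x y)) (token_rungs x y)"
      proof (intro sum_mono)
        fix e assume "e \<in> token_rungs x y"
        then have "e \<in> edges (graph x y)" using token_rungs_edges by blast
        then show "1 \<le> weight (graph x y) e"
          using weighted_graph[of x y] unfolding weighted_graph_def by blast
      qed
      also have "\<dots> \<le> cut_weight (graph x y) C"
        by (rule cut_weight_ge_sum[OF weighted_graph token_rungs_edges cross])
      finally show ?thesis .
    qed (use assms(2) in linarith)
  qed
qed

section \<open>Simulating the strand graph\<close>

text \<open>The wiring depends on \<open>y\<close> at column \<open>l - 1\<close> and on
  \<open>x\<close> at column 0, and its influence advances one column per round apart from
  shortcuts. While \<open>2 * t + 1 < l\<close>, the two zones together contain every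
  vertex.\<close>

definition left_zone :: "nat \<Rightarrow> nat set" where "left_zone t = {v. v < n \<and> col v + t + 1 < l}"
definition right_zone :: "nat \<Rightarrow> nat set" where "right_zone t = {v. v < n \<and> t < col v}"
definition shortcuts_over :: "nat \<Rightarrow> (nat \<times> nat) set" where
  "shortcuts_over b = {(u, v). shortcut u v \<and> col u < b \<and> b \<le> col v}"
text \<open>Senders come first: the left zone has to be told what runs from right to left, hence the
  converse, and the right zone what runs from left to right.\<close>

definition crossing :: "nat \<Rightarrow> (nat \<times> nat) set" where
  "crossing t = (shortcuts_over (l - Suc t))\<inverse> \<union> shortcuts_over (Suc t)"

text \<open>At each level at most one shortcut passes over the gap before column \<open>b\<close>:
  its lower end is \<open>b - 1\<close> rounded down to a multiple of \<open>2 ^ k\<close>. Since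
  \<open>l \<le> 2 ^ \<kappa>\<close>, only levels below \<open>\<kappa>\<close> occur.\<close>

lemma card_shortcuts_over: "finite (shortcuts_over b) \<and> card (shortcuts_over b) \<le> \<kappa>"
proof -
  let ?f = "\<lambda>k. (cell 0 (2 ^ k * ((b - 1) div 2 ^ k)), cell 0 (2 ^ k * Suc ((b - 1) div 2 ^ k)))"
  have sub: "shortcuts_over b \<subseteq> ?f ` {..<\<kappa>}"
  proof
    fix p assume "p \<in> shortcuts_over b"
    then obtain u v where p: "p = (u, v)" "shortcut u v" "col u < b" "b \<le> col v"
      by (auto simp: shortcuts_over_def)
    from p(2) show "p \<in> ?f ` {..<\<kappa>}"
    proof cases
      case (1 k j)
      have lt: "2 ^ k * j < l" using 1 by simp
      have "2 ^ k * j < b" "b \<le> 2 ^ k * Suc j"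
        using p 1 lt rows_pos by (simp_all del: mult_Suc_right)
      then have "(b - 1) div 2 ^ k = j"
        by (intro div_nat_eqI) (auto simp: mult.commute)
      moreover have "(2::nat) ^ k < 2 ^ \<kappa>"
      proof -
        have "2 ^ k \<le> 2 ^ k * Suc j" by simp
        then show ?thesis using 1(4) l\<kappa> by linarith
      qed
      then have "k < \<kappa>" by simp
      ultimately show ?thesis using p 1 by auto
    qed
  qed
  then have "card (shortcuts_over b) \<le> card {..<\<kappa>}"
    by (intro surj_card_le) auto
  then show ?thesis using finite_subset[OF sub] by simp
qed

text \<open>Only \<open>right_end\<close> edges depend on \<open>y\<close>, and both their ends lie
  in the last column.\<close>

lemma heavy_left_local:
  assumes "heavy x y u v" "col u + 1 < l \<or> col v + 1 < l"
  shows "heavy x y' u v"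
  using assms(1)
proof cases
  case (left_end k p)
  then have "layer x y k = layer x y' k" by (simp add: layer_def)
  then show ?thesis using left_end heavy.left_end[of k p x y'] by simp
next
  case (right_end k p)
  then have "col u = l - 1" "col v = l - 1"
    using l_pos by (simp_all add: strand_less_rows layer_less_3)
  then show ?thesis using assms(2) l_pos by simp
next
  case final
  show ?thesis unfolding final(1,2) by (rule heavy.final[OF final(3)])
qed (auto intro: heavy.intros)

lemma heavy_right_local:
  assumes "heavy x y u v" "0 < col u \<or> 0 < col v"
  shows "heavy x' y u v"
  using assms(1)
proof cases
  case (right_end k p)
  then have "layer x y k = layer x' y k" by (simp add: layer_def)
  then show ?thesis using right_end heavy.right_end[of k p x' y] by simp
next
  case (left_end k p)
  then have "col u = 0" "col v = 0"
    using l_pos by (simp_all add: strand_less_rows layer_less_3)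
  then show ?thesis using assms(2) by simp
next
  case final
  show ?thesis unfolding final(1,2) by (rule heavy.final[OF final(3)])
qed (auto intro: heavy.intros)

lemma start_graph_eq:
  assumes "\<And>u. heavy x y u v \<longleftrightarrow> heavy x' y' u v" "\<And>u. heavy x y v u \<longleftrightarrow> heavy x' y' v u"
  shows "start (graph x y) v = start (graph x' y') v"
  unfolding start_def edges_graph weight_graph assms ..

lemma heavy_not_shortcut: "shortcut u v \<Longrightarrow> \<not> heavy x y u v \<and> \<not> heavy x y v u"
  using heavy_col[of x y u v] heavy_col[of x y v u] shortcut_less[of u v] by linarith

lemma edge_col_cases:
  assumes "{u, v} \<in> edges (graph x y)"
  shows "u < n" "v < n" "(col u \<le> Suc (col v) \<and> col v \<le> Suc (col u)) \<or> shortcut u v \<or> shortcut v u"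
  using assms weighted_graph_edgeD[OF weighted_graph assms] heavy_col[of x y u v] heavy_col[of x y v u]
    rung_less[of u v] rung_less[of v u]
  by (auto simp: edges_graph)

lemma two_party_graph:
  assumes T: "2 * T + 1 < l"
  shows "two_party (Pow {..<m}) (Pow {..<m}) graph {..<n} left_zone right_zone crossing (2 * \<kappa>) T"
proof
  show "start (graph x y) v = start (graph x y') v" if "v \<in> left_zone 0" for x y y' v
    using that by (intro start_graph_eq iffI; elim heavy_left_local) (auto simp: left_zone_def)
  show "start (graph x y) v = start (graph x' y) v" if "v \<in> right_zone 0" for x x' y v
    using that by (intro start_graph_eq iffI; elim heavy_right_local) (auto simp: right_zone_def)
  show "u \<in> left_zone t \<or> (u, v) \<in> crossing t"
    if "t < T" "v \<in> left_zone (Suc t)" "{u, v} \<in> edges (graph x y)" for t x y u v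
    using that edge_col_cases[OF that(3)] shortcut_less[of u v]
    by (auto simp: left_zone_def crossing_def shortcuts_over_def)
  show "u \<in> right_zone t \<or> (u, v) \<in> crossing t"
    if "t < T" "v \<in> right_zone (Suc t)" "{u, v} \<in> edges (graph x y)" for t x y u v
    using that edge_col_cases[OF that(3)] shortcut_less[of v u]
    by (auto simp: right_zone_def crossing_def shortcuts_over_def)
  show "u \<in> left_zone t \<union> right_zone t" if "t < T" "(u, v) \<in> crossing t" for t u v
    using that T shortcut_less[of u v] shortcut_less[of v u]
    by (auto simp: left_zone_def right_zone_def crossing_def shortcuts_over_def)
  show "weight (graph x y) {u, v} = 1" if "(u, v) \<in> crossing t" for t x y u v
    using that heavy_not_shortcut by (auto simp: crossing_def shortcuts_over_def weight_graph)
  show "finite (crossing t)" for t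
    using card_shortcuts_over by (simp add: crossing_def)
  show "card (crossing t) \<le> 2 * \<kappa>" for t
    unfolding crossing_def
    using card_Un_le[of "(shortcuts_over (l - Suc t))\<inverse>" "shortcuts_over (Suc t)"]
      card_shortcuts_over[of "l - Suc t"] card_shortcuts_over[of "Suc t"] by simp
qed (auto simp: left_zone_def right_zone_def)

text \<open>A cell in column 0, which stays in the left zone, whose side of the light cut tells
  whether the token ends in position 2.\<close>

definition probe :: nat where "probe = cell (strand (4 * m) 2) 0"

lemma decider_lower_bound:
  assumes T: "2 * T + 1 < l" and eps: "0 \<le> \<epsilon>" "\<epsilon> < 1 / 2"
    and local: "\<And>\<sigma> \<sigma>'. \<sigma> 0 = \<sigma>' 0 \<Longrightarrow> \<sigma> probe = \<sigma>' probe \<Longrightarrow> \<Phi> \<sigma> = \<Phi> \<sigma>'"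
    and yes: "\<And>x y. token x y (4 * m) = 2 \<Longrightarrow> measure_pmf.prob (execution B A (graph x y) T) {\<sigma>. \<Phi> \<sigma>} \<ge> 1 - \<epsilon>"
    and no: "\<And>x y. token x y (4 * m) \<noteq> 2 \<Longrightarrow> measure_pmf.prob (execution B A (graph x y) T) {\<sigma>. \<Phi> \<sigma>} \<le> \<epsilon>"
  shows "(1 - 2 * \<epsilon>) / 6 \<le> (2 ^ Suc B) ^ (2 * \<kappa> * T) * (7 / 8) ^ m"
proof -
  interpret two_party "Pow {..<m}" "Pow {..<m}" graph "{..<n}" left_zone right_zone crossing "2 * \<kappa>" T
    by (rule two_party_graph[OF T])
  have probe: "probe < n" "col probe = 0"
    using l_pos by (simp_all add: probe_def cell_less strand_less_rows)
  have "(1 - 2 * \<epsilon>) / 6 \<le> (2 ^ Suc B) ^ (2 * \<kappa> * T) * (7 / 8) ^ card {..<m}"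
  proof (rule mod3_decider_correlation[where f = "\<lambda>x y. measure_pmf.prob (execution B A (graph x y) T) {\<sigma>. \<Phi> \<sigma>}"])
    show "\<bar>\<Sum>x\<in>Pow {..<m}. \<Sum>y\<in>Pow {..<m}. mod3_sign x y * measure_pmf.prob (execution B A (graph x y) T) {\<sigma>. \<Phi> \<sigma>}\<bar>
        \<le> (2 ^ Suc B) ^ (2 * \<kappa> * T) * (2 * (7 / 2) ^ card {..<m})"
    proof (rule correlation_bound)
      show "\<Phi> \<sigma> = \<Phi> \<sigma>'" if "\<And>v. v \<in> left_zone T \<Longrightarrow> \<sigma> v = \<sigma>' v" for \<sigma> \<sigma>'
        by (rule local; rule that) (use T probe D_less in \<open>auto simp: left_zone_def col_path\<close>)
    qed (rule mod3_sign_rectangle, auto)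
    show "1 \<le> ((2::real) ^ Suc B) ^ (2 * \<kappa> * T)"
      by (intro one_le_power) simp
  qed (use eps yes no in \<open>auto simp: token_eq_2_iff[symmetric]\<close>)
  then show ?thesis by simp
qed

end

text \<open>With \<open>fin\<close> true, the connectivity is at least \<open>M\<close> or equal to
  \<open>\<Lambda>\<close>, which an approximation must tell apart. With \<open>fin\<close> false it
  is always \<open>\<Lambda>\<close>, and the answer is whether the cut separates
  \<open>probe\<close> from vertex \<open>0\<close>.\<close>

lemma grid_lower_bound:
  assumes eps: "0 \<le> \<epsilon>" "\<epsilon> < 1 / 2" and W: "W = UNIV \<or> W = \<nat>" and \<alpha>: "1 \<le> \<alpha>"
    and l: "2 \<le> l" "l \<le> 2 ^ \<kappa>" and D: "\<kappa> + 2 \<le> D div 2" "D + 1 + (12 * m + 4) * l \<le> n"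
    and T: "2 * T + 1 < l"
  shows "approximates_connectivity B \<alpha> \<epsilon> (inputs W n D) T A \<Longrightarrow>
      (1 - 2 * \<epsilon>) / 6 \<le> (2 ^ Suc B) ^ (2 * \<kappa> * T) * (7 / 8) ^ m"
    and "computes_min_cut_knowing_connectivity B \<alpha> \<epsilon> (inputs W n D) T A' \<Longrightarrow>
      (1 - 2 * \<epsilon>) / 6 \<le> (2 ^ Suc B) ^ (2 * \<kappa> * T) * (7 / 8) ^ m"
proof -
  define \<Lambda> where "\<Lambda> = real ((4 * m + 1) * l)"
  define M where "M = real (nat \<lceil>\<alpha> * \<Lambda>\<rceil> + 1)"
  have \<Lambda>: "\<Lambda> \<ge> 1"
  proof -
    have "1 \<le> (4 * m + 1) * l" using l(1) by simp
    then show ?thesis unfolding \<Lambda>_def by (metis of_nat_1 of_nat_mono)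
  qed
  have "\<Lambda> \<le> \<alpha> * \<Lambda>"
    using mult_right_mono[of 1 \<alpha> \<Lambda>] \<alpha> \<Lambda> by simp
  moreover have M: "\<alpha> * \<Lambda> < M" unfolding M_def by linarith
  ultimately have M': "\<Lambda> \<le> M" "1 < M"
    using \<Lambda> by linarith+
  have "M \<in> \<nat>" unfolding M_def by (rule of_nat_in_Nats)
  then have M_W: "M \<in> W" "1 \<in> W"
    using W by auto
  show "(1 - 2 * \<epsilon>) / 6 \<le> (2 ^ Suc B) ^ (2 * \<kappa> * T) * (7 / 8) ^ m"
    if A: "approximates_connectivity B \<alpha> \<epsilon> (inputs W n D) T A"
  proof -
    interpret strand_graph D n m l \<kappa> M True
      using l D M' by unfold_locales auto
    note prob = approximates_connectivityD[OF A graph_inputs[OF M_W]]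
    show ?thesis
    proof (rule decider_lower_bound[where \<Phi> = "\<lambda>\<sigma>. M \<le> answer A (\<sigma> 0)", OF T eps])
      fix x y assume *: "token x y (4 * m) = 2"
      show "measure_pmf.prob (execution B A (graph x y) T) {\<sigma>. M \<le> answer A (\<sigma> 0)} \<ge> 1 - \<epsilon>"
      proof (rule prob_ge_if_implied[OF prob], drule CollectD)
        fix \<sigma> :: "nat \<Rightarrow> history"
        assume "\<forall>v\<in>verts (graph x y). answer A (\<sigma> v) \<in>
          {edge_connectivity (graph x y)..\<alpha> * edge_connectivity (graph x y)}"
        then have "edge_connectivity (graph x y) \<le> answer A (\<sigma> 0)"
          using D_less by auto
        then show "M \<le> answer A (\<sigma> 0)"
          using edge_connectivity_heavy[OF TrueI *] by simp
      qed
    next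
      fix x y assume *: "token x y (4 * m) \<noteq> 2"
      show "measure_pmf.prob (execution B A (graph x y) T) {\<sigma>. M \<le> answer A (\<sigma> 0)} \<le> \<epsilon>"
      proof (rule prob_le_if_disjoint[OF prob], drule CollectD)
        fix \<sigma> :: "nat \<Rightarrow> history"
        assume "\<forall>v\<in>verts (graph x y). answer A (\<sigma> v) \<in>
          {edge_connectivity (graph x y)..\<alpha> * edge_connectivity (graph x y)}"
        then have "answer A (\<sigma> 0) \<le> \<alpha> * edge_connectivity (graph x y)"
          using D_less by auto
        then show "\<not> M \<le> answer A (\<sigma> 0)"
          using edge_connectivity_light[of x y] * M M'(1) by (simp add: \<Lambda>_def)
      qed
    qed simp
  qed
  show "(1 - 2 * \<epsilon>) / 6 \<le> (2 ^ Suc B) ^ (2 * \<kappa> * T) * (7 / 8) ^ m"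
    if A: "computes_min_cut_knowing_connectivity B \<alpha> \<epsilon> (inputs W n D) T A'"
  proof -
    interpret strand_graph D n m l \<kappa> M False
      using l D M' by unfold_locales auto
    let ?A = "A' \<Lambda>"
    have ec: "edge_connectivity (graph x y) = \<Lambda>" for x y
      using edge_connectivity_light[of x y] M'(1) by (simp add: \<Lambda>_def)
    note prob = computes_min_cutD[OF A graph_inputs[OF M_W] ec]
    have probe: "probe \<in> C \<longleftrightarrow> ((0 \<in> C) \<noteq> (2 = token x y (4 * m)))"
      if "approx_min_cut \<alpha> (graph x y) C" for x y C
      using that light_cut(3)[of x y C "4 * m" 2 0] l_pos M
      unfolding approx_min_cut_def ec probe_def by simp
    have probe_less: "probe < n"
      using l_pos by (simp add: probe_def cell_less strand_less_rows)
    show ?thesis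
    proof (rule decider_lower_bound[where A = ?A and \<Phi> = "\<lambda>\<sigma>. answer ?A (\<sigma> probe) \<noteq> answer ?A (\<sigma> 0)", OF T eps])
      fix x y assume *: "token x y (4 * m) = 2"
      show "measure_pmf.prob (execution B ?A (graph x y) T) {\<sigma>. answer ?A (\<sigma> probe) \<noteq> answer ?A (\<sigma> 0)} \<ge> 1 - \<epsilon>"
      proof (rule prob_ge_if_implied[OF prob], drule CollectD)
        fix \<sigma> :: "nat \<Rightarrow> history"
        assume C: "approx_min_cut \<alpha> (graph x y) {v \<in> verts (graph x y). answer ?A (\<sigma> v)}"
        show "answer ?A (\<sigma> probe) \<noteq> answer ?A (\<sigma> 0)"
          using probe[OF C] * probe_less D_less by simp
      qed
    next
      fix x y assume *: "token x y (4 * m) \<noteq> 2"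
      show "measure_pmf.prob (execution B ?A (graph x y) T) {\<sigma>. answer ?A (\<sigma> probe) \<noteq> answer ?A (\<sigma> 0)} \<le> \<epsilon>"
      proof (rule prob_le_if_disjoint[OF prob], drule CollectD)
        fix \<sigma> :: "nat \<Rightarrow> history"
        assume C: "approx_min_cut \<alpha> (graph x y) {v \<in> verts (graph x y). answer ?A (\<sigma> v)}"
        show "\<not> answer ?A (\<sigma> probe) \<noteq> answer ?A (\<sigma> 0)"
          using probe[OF C] * probe_less D_less by simp
      qed
    qed simp
  qed
qed

section \<open>The lower bound\<close>

text \<open>About \<open>x\<close> columns, \<open>\<kappa>\<close> about \<open>L\<close>, and rows
  in proportion to \<open>n / x = x * B * L\<close>: the transcript, of order
  \<open>B * L * T\<close> bits, is then too short compared with \<open>m\<close> if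
  \<open>T\<close> is a small fraction of \<open>x\<close>.\<close>

lemma communication_to_rounds:
  fixes D B T n m\<^sub>0 :: nat and L x \<delta> :: real
  defines "L \<equiv> log 2 (real n)" and "x \<equiv> sqrt (real n / (real B * L))"
  assumes bound: "\<And>l \<kappa> m. \<lbrakk>2 \<le> l; l \<le> 2 ^ \<kappa>; \<kappa> + 2 \<le> D div 2; D + 1 + (12 * m + 4) * l \<le> n; 2 * T + 1 < l\<rbrakk> \<Longrightarrow>
      \<delta> \<le> (2 ^ Suc B) ^ (2 * \<kappa> * T) * (7 / 8) ^ m"
    and m0: "(7 / 8) ^ m\<^sub>0 < \<delta>" and n: "2 ^ (20 * m\<^sub>0 + 10) \<le> n"
    and B: "1 \<le> B" and D: "10 * L \<le> real D" "real D < x"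
  shows "x / 9216 \<le> real T"
proof (rule ccontr)
  assume "\<not> x / 9216 \<le> real T"
  then have T: "9216 * real T < x" by simp
  have n0: "0 < real n" using n by (metis gr0I le_zero_eq of_nat_0_less_iff power_not_zero zero_neq_numeral)
  have n': "2 ^ (20 * m\<^sub>0 + 10) \<le> real n"
    using n by (metis of_nat_le_iff of_nat_numeral of_nat_power)
  have L: "20 * real m\<^sub>0 + 10 \<le> L"
    using n' n0 unfolding L_def by (subst le_log_iff) (auto simp: powr_realpow[symmetric])
  have L10: "10 \<le> L" using L by linarith
  have x: "x > 100" using D L10 by linarith
  have BL: "1 \<le> real B * L"
    using B L10 mult_mono[of 1 "real B" 1 L] by simp
  have xx: "x * x * (real B * L) = real n"
  proof -
    have "x * x = real n / (real B * L)"
      unfolding x_def using BL by (intro real_sqrt_mult_self[THEN trans] abs_of_nonneg) simp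
    moreover have "real B * L \<noteq> 0" using BL by linarith
    ultimately show ?thesis by (metis nonzero_eq_divide_eq)
  qed
  define z where "z = x * (real B * L)"
  have xz: "x * z = real n" using xx by (simp add: z_def mult_ac)
  have "x * 1 \<le> z" unfolding z_def using BL x by (intro mult_left_mono) auto
  then have zx: "x \<le> z" by simp
  have "x * x \<le> real n" using mult_left_mono[OF zx, of x] x xz by simp
  then have n100: "100 * x \<le> real n" using mult_right_mono[of 100 x x] x by linarith
  define l where "l = nat \<lceil>x\<rceil>"
  have l: "x \<le> real l" "real l \<le> x + 1" using x unfolding l_def by linarith+
  define \<kappa> where "\<kappa> = nat \<lceil>L\<rceil>"
  have \<kappa>: "L \<le> real \<kappa>" "real \<kappa> \<le> L + 1" using L10 unfolding \<kappa>_def by linarith+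
  \<comment> \<open>With \<open>l \<le> 2 * x\<close> the main part of the grid takes at most half
    of the vertices: \<open>12 * (z / 48) * (2 * x) = n / 2\<close>.\<close>
  define m where "m = nat \<lfloor>z / 48\<rfloor>"
  have m: "real m \<le> z / 48" "z / 48 - 1 \<le> real m" using zx x unfolding m_def by linarith+
  have "real n = 2 powr L" using n0 unfolding L_def by simp
  also have "\<dots> \<le> 2 powr real \<kappa>" using \<kappa>(1) by simp
  also have "\<dots> = real (2 ^ \<kappa>)" by (simp add: powr_realpow)
  finally have n\<kappa>: "n \<le> 2 ^ \<kappa>" by (simp only: of_nat_le_iff)
  have "real l \<le> real n" using l x n100 by linarith
  then have 1: "l \<le> 2 ^ \<kappa>" using n\<kappa> by simp
  have 2: "2 \<le> l" "2 * T + 1 < l" using l T x by linarith+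
  \<comment> \<open>Here the logarithmic lower limit on the diameter enters:
    \<open>2 * (L + 3) \<le> 10 * L\<close>.\<close>
  have 3: "\<kappa> + 2 \<le> D div 2"
  proof -
    have "real (2 * (\<kappa> + 2)) \<le> real D" using \<kappa> D L10 by simp
    then have "2 * (\<kappa> + 2) \<le> D" by (simp only: of_nat_le_iff)
    then show ?thesis by presburger
  qed
  have 4: "D + 1 + (12 * m + 4) * l \<le> n"
  proof -
    have "(12 * real m + 4) * real l \<le> (12 * (z / 48) + 4) * (2 * x)"
      using m(1) l x by (intro mult_mono) auto
    also have "\<dots> = real n / 2 + 8 * x"
      using xz by (simp add: field_simps)
    finally have "real (D + 1 + (12 * m + 4) * l) \<le> real n"
      using n100 D x by simp
    then show ?thesis by (simp only: of_nat_le_iff)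
  qed
  define E where "E = Suc B * (2 * \<kappa> * T)"
  \<comment> \<open>The constant is \<open>9216 = 8 * 1152\<close>: the 8 comes from
    \<open>B + 1 \<le> 2 * B\<close> and \<open>2 * \<kappa> \<le> 4 * L\<close>, and
    \<open>12 * z / 1152 = z / 96\<close> leaves room for rounding \<open>z / 48\<close>
    down.\<close>
  have E: "12 * E \<le> m"
  proof -
    have "real E = (real B + 1) * (2 * real \<kappa>) * real T" unfolding E_def by (simp add: algebra_simps)
    also have "\<dots> \<le> (2 * real B) * (2 * (2 * L)) * (x / 9216)"
      using B \<kappa> L10 T by (intro mult_mono) auto
    also have "\<dots> = z / 1152" by (simp add: z_def)
    finally have "12 * real E \<le> z / 96" by simp
    also have "\<dots> \<le> real m" using m(2) zx x by linarith
    finally show ?thesis by linarith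
  qed
  have "2 * real m\<^sub>0 \<le> real m" using m(2) zx D L by linarith
  then have m0m: "m\<^sub>0 \<le> m - 6 * E" using E by linarith
  \<comment> \<open>Each transcript bit is paid for by six factors 7/8; by
    \<open>12 * E \<le> m\<close> at least half of the \<open>m\<close> factors remain.\<close>
  have "(2::real) ^ E \<le> ((8 / 7) ^ 6) ^ E"
    by (intro power_mono) (simp_all add: eval_nat_numeral)
  also have "\<dots> = (8 / 7) ^ (6 * E)" by (simp only: power_mult)
  finally have pow: "(2::real) ^ E \<le> (8 / 7) ^ (6 * E)" .
  have split: "(7 / 8 :: real) ^ m = (7 / 8) ^ (6 * E) * (7 / 8) ^ (m - 6 * E)"
    using E by (simp flip: power_add)
  have "(2::real) ^ E * (7 / 8) ^ m \<le> (8 / 7) ^ (6 * E) * (7 / 8) ^ m"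
    using pow by (rule mult_right_mono) simp
  also have "\<dots> = ((8 / 7) * (7 / 8)) ^ (6 * E) * (7 / 8) ^ (m - 6 * E)"
    by (simp only: split power_mult_distrib mult.assoc)
  also have "\<dots> = (7 / 8) ^ (m - 6 * E)" by simp
  also have "\<dots> \<le> (7 / 8) ^ m\<^sub>0" using m0m by (intro power_decreasing) auto
  finally have "(2::real) ^ E * (7 / 8) ^ m < \<delta>" using m0 by linarith
  moreover have "\<delta> \<le> (2 ^ Suc B) ^ (2 * \<kappa> * T) * (7 / 8) ^ m"
    by (rule bound[OF 2(1) 1 3 4 2(2)])
  ultimately show False by (simp only: E_def power_mult)
qed

text \<open>The larger of the two terms decides which bound is used. Their sum is at most twice the
  larger one, hence 18432 as twice 9216.\<close>

lemma rounds_lower_bound: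
  fixes D B T n m\<^sub>0 :: nat and \<delta> :: real
  assumes grid: "\<And>l \<kappa> m. \<lbrakk>2 \<le> l; l \<le> 2 ^ \<kappa>; \<kappa> + 2 \<le> D div 2; D + 1 + (12 * m + 4) * l \<le> n; 2 * T + 1 < l\<rbrakk> \<Longrightarrow>
      \<delta> \<le> (2 ^ Suc B) ^ (2 * \<kappa> * T) * (7 / 8) ^ m"
    and diam: "16 \<le> D \<Longrightarrow> D div 4 \<le> Suc T"
    and m0: "(7 / 8) ^ m\<^sub>0 < \<delta>" and n: "2 ^ (20 * m\<^sub>0 + 10) \<le> n"
    and B: "1 \<le> B" and D: "10 * log 2 (real n) \<le> real D"
  shows "1 / 18432 * (real D + sqrt (real n / (real B * log 2 (real n)))) \<le> real T"
proof (cases "real D < sqrt (real n / (real B * log 2 (real n)))")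
  case True
  have "sqrt (real n / (real B * log 2 (real n))) / 9216 \<le> real T"
    by (rule communication_to_rounds[OF _ m0 n B D True]) (rule grid)
  then show ?thesis
    using True by argo
next
  case False
  have "(2::real) ^ 2 \<le> 2 ^ (20 * m\<^sub>0 + 10)" by (intro power_increasing) auto
  also have "\<dots> \<le> real n" using n by (metis of_nat_le_iff of_nat_numeral of_nat_power)
  finally have "2 \<le> log 2 (real n)" by (subst le_log_iff) auto
  then have "16 \<le> D" using D by linarith
  \<comment> \<open>\<open>D div 4 \<le> Suc T\<close> gives \<open>D \<le> 4 * T + 7\<close>, and
    \<open>D \<ge> 16\<close> absorbs the 7.\<close>
  then have "real D \<le> 8 * real T" using diam by linarith
  moreover define s where "s = sqrt (real n / (real B * log 2 (real n)))"
  ultimately show ?thesis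
    using False unfolding s_def[symmetric] by simp
qed

theorem theorem6p3:
  fixes \<epsilon> :: real and W :: "real set"
  assumes "0 \<le> \<epsilon>" and "\<epsilon> < 1 / 2"
    and "W = UNIV \<or> W = \<nat>"
  shows "\<exists>c > 0. \<exists>K > 0. \<exists>N::nat. \<forall>n \<ge> N. \<forall>(D::nat) (B::nat) (\<alpha>::real) (T::nat).
    K * log 2 (real n) \<le> real D \<and> D < n \<and> 1 \<le> B \<and> 1 \<le> \<alpha> \<longrightarrow>
      (\<forall>A. approximates_connectivity B \<alpha> \<epsilon> (inputs W n D) T A \<longrightarrow>
         real T \<ge> c * (real D + sqrt (real n / (real B * log 2 (real n))))) \<and>
      (\<forall>A. computes_min_cut_knowing_connectivity B \<alpha> \<epsilon> (inputs W n D) T A \<longrightarrow>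
         real T \<ge> c * (real D + sqrt (real n / (real B * log 2 (real n)))))"
proof -
  have "0 < (1 - 2 * \<epsilon>) / 6" using assms(2) by simp
  \<comment> \<open>The error enters only through \<open>m\<^sub>0\<close>, and thus only through
    the threshold for \<open>n\<close>; the two constants are absolute.\<close>
  then obtain m\<^sub>0 where m0: "(7 / 8) ^ m\<^sub>0 < (1 - 2 * \<epsilon>) / 6"
    using real_arch_pow_inv[of "(1 - 2 * \<epsilon>) / 6" "7 / 8"] by auto
  have conn: "1 / 18432 * (real D + sqrt (real n / (real B * log 2 (real n)))) \<le> real T"
    if n: "2 ^ (20 * m\<^sub>0 + 10) \<le> n" and D: "10 * log 2 (real n) \<le> real D" "D < n" and B: "1 \<le> B"
      and \<alpha>: "1 \<le> \<alpha>" and A: "approximates_connectivity B \<alpha> \<epsilon> (inputs W n D) T A" for n D B T \<alpha> A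
    by (rule rounds_lower_bound[OF grid_lower_bound(1)[OF assms \<alpha> _ _ _ _ _ A]
          diameter_lower_bound(1)[OF assms(2,3) _ D(2) \<alpha> A] m0 n B D(1)])
  have cut: "1 / 18432 * (real D + sqrt (real n / (real B * log 2 (real n)))) \<le> real T"
    if n: "2 ^ (20 * m\<^sub>0 + 10) \<le> n" and D: "10 * log 2 (real n) \<le> real D" "D < n" and B: "1 \<le> B"
      and \<alpha>: "1 \<le> \<alpha>" and A: "computes_min_cut_knowing_connectivity B \<alpha> \<epsilon> (inputs W n D) T A" for n D B T \<alpha> A
    by (rule rounds_lower_bound[OF grid_lower_bound(2)[OF assms \<alpha> _ _ _ _ _ A]
          diameter_lower_bound(2)[OF assms(2,3) _ D(2) \<alpha> A] m0 n B D(1)])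
  show ?thesis
    by (rule exI[of _ "1 / 18432"], rule conjI, simp, rule exI[of _ 10], rule conjI, simp,
        rule exI[of _ "2 ^ (20 * m\<^sub>0 + 10)"]) (blast intro: conn cut)
qed

end
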